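(* Let $G$ be a graph with no isolated vertices, and suppose $G$ has a chain decomposition rooted at some $r\in V(G)$. Then there exists a set of four spanning trees of $G$ that are pairwise edge-independent with root $r$.
   Context: Graphs are multigraphs (parallel edges and loops allowed; a loop adds $2$ to the degree; a loop is a cycle of length one and two parallel edges form a cycle of length two). Paths and cycles are simple. The degree of a vertex in a subgraph not containing it is $0$. An up chain of $G$ with respect to a pair of edge-disjoint subgraphs $(H,\overline{H})$ is a subgraph of $G$, edge-disjoint from $H$ and $\overline{H}$, which is either (i) a path with at least one edge such that every vertex is either $r$ or has degree at least two in $\overline{H}$, and each end is either $r$ or lies in $H$; or (ii) a cycle such that every vertex is either $r$ or has degree at least two in $\overline{H}$, and some vertex $v$ of it is either $r$ or has degree at least two in $H$ ($v$ is regarded as both ends, all other vertices internal). A down chain with respect to $(H,\overline{H})$ is an up chain with respect to $(\overline{H},H)$. A one-way chain with respect to $(H,\overline{H})$ is the subgraph induced by a single edge $e\notin E(H)\cup E(\overline{H})$ with ends $u$ (tail) and $v$ (head) such that $u$ is $r$ or has degree at least two in $H$, and $v$ is $r$ or has degree at least two in $\overline{H}$. A sequence $G_0,\dots,G_m$ of subgraphs of $G$ is a chain decomposition of $G$ rooted at $r$ if, writing $H_i=G_0\cup\cdots\cup G_{i-1}$ and $\overline{H_i}=G_{i+1}\cup\cdots\cup G_m$ (so $H_0$ and $\overline{H_m}$ are null), the sets $E(G_0),\dots,E(G_m)$ partition $E(G)$ and each $G_i$ is an up chain, a down chain, or a one-way chain with respect to $(H_i,\overline{H_i})$. Two subtrees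 $T_1,T_2$ of $G$ are edge-independent with root $r$ if both contain $r$ and for every $v\in V(T_1)\cap V(T_2)$ the unique $r$–$v$ paths in $T_1$ and $T_2$ are edge-disjoint. *)

theory Defs
  imports "HOL-Library.Multiset" "HOL-Library.Disjoint_Sets"
begin

text \<open>The two ends of an edge form a multiset of size two; a loop at \<open>v\<close> has ends \<open>{#v, v#}\<close>.\<close>

record ('v, 'e) mgraph =
  verts :: "'v set"
  edges :: "'e set"
  ends :: "'e \<Rightarrow> 'v multiset"

locale multigraph =
  fixes G :: "('v, 'e) mgraph"
  assumes finite_verts: "finite (verts G)"
    and finite_edges: "finite (edges G)"
    and size_ends: "e \<in> edges G \<Longrightarrow> size (ends G e) = 2"
    and ends_in_verts: "e \<in> edges G \<Longrightarrow> set_mset (ends G e) \<subseteq> verts G"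

text \<open>A loop contributes 2; a vertex outside the graph has degree 0.\<close>

definition degree :: "('v, 'e) mgraph \<Rightarrow> 'v \<Rightarrow> nat" where
  "degree G v = (\<Sum>e\<in>edges G. count (ends G e) v)"

definition isolated :: "('v, 'e) mgraph \<Rightarrow> 'v \<Rightarrow> bool" where
  "isolated G v \<longleftrightarrow> v \<in> verts G \<and> degree G v = 0"

text \<open>As the end map is total, subgraphs are required to share all of it, so that a subgraph is
  determined by its vertices and edges.\<close>

definition subgraph :: "('v, 'e) mgraph \<Rightarrow> ('v, 'e) mgraph \<Rightarrow> bool" where
  "subgraph H G \<longleftrightarrow>
     multigraph H \<and> verts H \<subseteq> verts G \<and> edges H \<subseteq> edges G \<and> ends H = ends G"

definition edge_disjoint :: "('v, 'e) mgraph \<Rightarrow> ('v, 'e) mgraph \<Rightarrow> bool" where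
  "edge_disjoint H K \<longleftrightarrow> edges H \<inter> edges K = {}"

definition union_subgraphs ::
    "('v, 'e) mgraph \<Rightarrow> (nat \<Rightarrow> ('v, 'e) mgraph) \<Rightarrow> nat set \<Rightarrow> ('v, 'e) mgraph" where
  "union_subgraphs G Gs I =
     \<lparr>verts = (\<Union>i\<in>I. verts (Gs i)), edges = (\<Union>i\<in>I. edges (Gs i)), ends = ends G\<rparr>"

text \<open>The graph \<open>P\<close> is itself a simple path with ends \<open>u\<close> and \<open>v\<close>; it may consist of a single
  vertex \<open>u = v\<close>.\<close>

definition path_graph :: "('v, 'e) mgraph \<Rightarrow> 'v \<Rightarrow> 'v \<Rightarrow> bool" where
  "path_graph P u v \<longleftrightarrow>
     (\<exists>vs es. length vs = Suc (length es) \<and> distinct vs \<and> hd vs = u \<and> last vs = v \<and>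
        verts P = set vs \<and> edges P = set es \<and>
        (\<forall>i < length es. ends P (es ! i) = {#vs ! i, vs ! Suc i#}))"

text \<open>Distinctness of \<open>es\<close> matters only for length two, where it forces two parallel edges.\<close>

definition cycle_graph :: "('v, 'e) mgraph \<Rightarrow> bool" where
  "cycle_graph C \<longleftrightarrow>
     (\<exists>vs es. vs \<noteq> [] \<and> length vs = length es \<and> distinct vs \<and> distinct es \<and>
        verts C = set vs \<and> edges C = set es \<and>
        (\<forall>i < length es. ends C (es ! i) = {#vs ! i, vs ! (Suc i mod length vs)#}))"

definition connected_graph :: "('v, 'e) mgraph \<Rightarrow> bool" where
  "connected_graph G \<longleftrightarrow>
     verts G \<noteq> {} \<and> (\<forall>u\<in>verts G. \<forall>v\<in>verts G. \<exists>P. subgraph P G \<and> path_graph P u v)"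

definition tree :: "('v, 'e) mgraph \<Rightarrow> bool" where
  "tree T \<longleftrightarrow> multigraph T \<and> connected_graph T \<and> (\<nexists>C. subgraph C T \<and> cycle_graph C)"

definition spanning_tree :: "('v, 'e) mgraph \<Rightarrow> ('v, 'e) mgraph \<Rightarrow> bool" where
  "spanning_tree T G \<longleftrightarrow> subgraph T G \<and> tree T \<and> verts T = verts G"

text \<open>Intended for trees, in which paths with given ends exist and are unique.\<close>

definition edge_independent ::
    "'v \<Rightarrow> ('v, 'e) mgraph \<Rightarrow> ('v, 'e) mgraph \<Rightarrow> bool" where
  "edge_independent r T1 T2 \<longleftrightarrow>
     r \<in> verts T1 \<and> r \<in> verts T2 \<and>
     (\<forall>v \<in> verts T1 \<inter> verts T2. \<forall>P1 P2.
        subgraph P1 T1 \<and> path_graph P1 r v \<and> subgraph P2 T2 \<and> path_graph P2 r v \<longrightarrow>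
        edge_disjoint P1 P2)"

text \<open>In the following three definitions \<open>H\<close> and \<open>K\<close> are edge-disjoint subgraphs of \<open>G\<close>; \<open>K\<close>
  plays the role of \<open>H\<close> overlined.\<close>

definition up_chain :: "('v, 'e) mgraph \<Rightarrow> 'v \<Rightarrow>
    ('v, 'e) mgraph \<Rightarrow> ('v, 'e) mgraph \<Rightarrow> ('v, 'e) mgraph \<Rightarrow> bool" where
  "up_chain G r H K C \<longleftrightarrow>
     subgraph C G \<and> edge_disjoint C H \<and> edge_disjoint C K \<and>
     ((\<exists>u v. path_graph C u v \<and> edges C \<noteq> {} \<and>
         (\<forall>w\<in>verts C. w = r \<or> degree K w \<ge> 2) \<and>
         (u = r \<or> u \<in> verts H) \<and> (v = r \<or> v \<in> verts H)) \<or>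
      (cycle_graph C \<and>
         (\<forall>w\<in>verts C. w = r \<or> degree K w \<ge> 2) \<and>
         (\<exists>v\<in>verts C. v = r \<or> degree H v \<ge> 2)))"

definition down_chain :: "('v, 'e) mgraph \<Rightarrow> 'v \<Rightarrow>
    ('v, 'e) mgraph \<Rightarrow> ('v, 'e) mgraph \<Rightarrow> ('v, 'e) mgraph \<Rightarrow> bool" where
  "down_chain G r H K C \<longleftrightarrow> up_chain G r K H C"

definition one_way_chain :: "('v, 'e) mgraph \<Rightarrow> 'v \<Rightarrow>
    ('v, 'e) mgraph \<Rightarrow> ('v, 'e) mgraph \<Rightarrow> ('v, 'e) mgraph \<Rightarrow> bool" where
  "one_way_chain G r H K C \<longleftrightarrow>
     (\<exists>e u v. e \<in> edges G \<and> e \<notin> edges H \<union> edges K \<and> ends G e = {#u, v#} \<and>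
        C = \<lparr>verts = {u, v}, edges = {e}, ends = ends G\<rparr> \<and>
        (u = r \<or> degree H u \<ge> 2) \<and> (v = r \<or> degree K v \<ge> 2))"

definition chain_decomposition ::
    "('v, 'e) mgraph \<Rightarrow> 'v \<Rightarrow> nat \<Rightarrow> (nat \<Rightarrow> ('v, 'e) mgraph) \<Rightarrow> bool" where
  "chain_decomposition G r m Gs \<longleftrightarrow>
     (\<forall>i\<le>m. subgraph (Gs i) G) \<and>
     (\<Union>i\<le>m. edges (Gs i)) = edges G \<and>
     disjoint_family_on (\<lambda>i. edges (Gs i)) {..m} \<and>
     (\<forall>i\<le>m.
        let H = union_subgraphs G Gs {..<i}; K = union_subgraphs G Gs {i<..m} in
        up_chain G r H K (Gs i) \<or> down_chain G r H K (Gs i) \<or> one_way_chain G r H K (Gs i))"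

end

theory Submission
  imports Defs Complex_Main
begin

text \<open>
  Grow the graph chain by chain from the root, discarding down chains. The chains met so far carry
  real heights on edges such that every vertex \<open>v \<noteq> r\<close> with at least two edges has a lower parent
  edge, leading to \<open>r\<close> through strictly decreasing heights, and an upper one, leading to \<open>r\<close> through
  strictly increasing heights; an up chain gets increasing heights strictly between those at its
  two ends, and a one-way edge leaves its head pending until a second edge arrives. Following lower
  and upper parent edges gives two edge-independent spanning trees. Their paths from \<open>v\<close> use only
  chains of index at most the index \<open>t v\<close> of the chain completing \<open>v\<close>. The same construction on
  the reversed decomposition gives two trees whose paths from \<open>v\<close> use only chains of index greater
  than \<open>t v\<close>, since the chains after \<open>t v\<close> already contain two edges at \<open>v\<close>.
\<close>

section \<open>Trees from parent maps\<close>

lemma listed_path: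
  assumes "multigraph T" "length vs = Suc (length es)" "distinct vs"
    and "set vs \<subseteq> verts T" "set es \<subseteq> edges T"
    and ends: "\<And>i. i < length es \<Longrightarrow> ends T (es ! i) = {#vs ! i, vs ! Suc i#}"
  shows "\<exists>P. subgraph P T \<and> path_graph P (hd vs) (last vs)"
proof -
  let ?P = "\<lparr>verts = set vs, edges = set es, ends = ends T\<rparr>"
  have "set_mset (ends T e) \<subseteq> set vs" if "e \<in> set es" for e
  proof -
    from that obtain i where "i < length es" "es ! i = e" by (metis in_set_conv_nth)
    then show ?thesis using ends[of i] assms(2) by simp
  qed
  then have "multigraph ?P"
    using assms by (auto simp: multigraph_def)
  then have "subgraph ?P T" using assms by (simp add: subgraph_def)
  moreover have "path_graph ?P (hd vs) (last vs)"
    unfolding path_graph_def using assms by (intro exI[of _ vs] exI[of _ es]) simp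
  ultimately show ?thesis by blast
qed

text \<open>A new vertex \<open>y\<close> is appended to the path; if \<open>y\<close> already lies
  on it, the path is cut off at \<open>y\<close> instead.\<close>

lemma path_graph_extend:
  assumes "multigraph T" "subgraph P T" "path_graph P u x" "e \<in> edges T" "ends T e = {#x, y#}"
  shows "\<exists>Q. subgraph Q T \<and> path_graph Q u y"
proof -
  obtain vs es where vs: "length vs = Suc (length es)" "distinct vs" "hd vs = u" "last vs = x"
      "verts P = set vs" "edges P = set es"
      "\<And>i. i < length es \<Longrightarrow> ends P (es ! i) = {#vs ! i, vs ! Suc i#}"
    using assms(3) unfolding path_graph_def by metis
  have P: "set vs \<subseteq> verts T" "set es \<subseteq> edges T" "ends P = ends T"
    using assms(2) vs(5,6) unfolding subgraph_def by auto
  have y: "y \<in> verts T"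
    using multigraph.ends_in_verts[OF assms(1,4)] assms(5) by simp
  show ?thesis
  proof (cases "y \<in> set vs")
    case True
    then obtain j where j: "j < length vs" "vs ! j = y" by (metis in_set_conv_nth)
    have "\<exists>Q. subgraph Q T \<and> path_graph Q (hd (take (Suc j) vs)) (last (take (Suc j) vs))"
      by (rule listed_path[of T _ "take j es"])
        (use assms(1) vs P j in \<open>auto dest: in_set_takeD\<close>)
    moreover have "hd (take (Suc j) vs) = u" using vs(3) by simp
    moreover have "last (take (Suc j) vs) = y" using j by (simp add: take_Suc_conv_app_nth)
    ultimately show ?thesis by simp
  next
    case False
    have "vs \<noteq> []" using vs(1) by auto
    then have x: "vs ! length es = x" using vs(1,4) by (simp add: last_conv_nth)
    have "\<exists>Q. subgraph Q T \<and> path_graph Q (hd (vs @ [y])) (last (vs @ [y]))"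
      by (rule listed_path[of T _ "es @ [e]"])
        (use assms vs P y False x in \<open>auto simp: nth_append less_Suc_eq\<close>)
    then show ?thesis using \<open>vs \<noteq> []\<close> vs(3) by simp
  qed
qed

lemma path_graph_of_walk:
  assumes T: "multigraph T" and u: "u \<in> verts T"
    and "(u, v) \<in> {(x, y). \<exists>e\<in>edges T. ends T e = {#x, y#}}\<^sup>*"
  shows "\<exists>P. subgraph P T \<and> path_graph P u v"
  using assms(3)
proof induction
  case base
  show ?case using listed_path[of T "[u]" "[]"] T u by simp
next
  case (step x y)
  then show ?case using path_graph_extend[OF T] by blast
qed

section \<open>Spanning trees given by parent edges of decreasing height\<close>

locale parent_map =
  fixes G :: "('v, 'e) mgraph" and r :: 'v and p :: "'v \<Rightarrow> 'e" and q :: "'v \<Rightarrow> 'v"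
    and h :: "'v \<Rightarrow> real"
  assumes graph: "multigraph G" and root: "r \<in> verts G"
    and parent_edge: "v \<in> verts G - {r} \<Longrightarrow> p v \<in> edges G"
    and ends_parent_edge: "v \<in> verts G - {r} \<Longrightarrow> ends G (p v) = {#v, q v#}"
    and descent: "v \<in> verts G - {r} \<Longrightarrow> q v = r \<or> h (q v) < h v"
begin

definition parent_tree :: "('v, 'e) mgraph" where
  "parent_tree = \<lparr>verts = verts G, edges = p ` (verts G - {r}), ends = ends G\<rparr>"

lemma parent_in_verts: "v \<in> verts G - {r} \<Longrightarrow> q v \<in> verts G"
  using multigraph.ends_in_verts[OF graph parent_edge] ends_parent_edge by simp

lemma subgraph_parent_tree: "subgraph parent_tree G"
proof -
  have "finite (verts G)" using graph by (simp add: multigraph_def)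
  then have "multigraph parent_tree"
    using graph parent_edge parent_in_verts ends_parent_edge
    by (auto simp: multigraph_def parent_tree_def)
  then show ?thesis using parent_edge by (auto simp: subgraph_def parent_tree_def)
qed

lemma connected_parent_tree: "connected_graph parent_tree"
proof -
  let ?A = "{(x, y). \<exists>e\<in>edges parent_tree. ends parent_tree e = {#x, y#}}"
  have sym: "(y, x) \<in> ?A" if "(x, y) \<in> ?A" for x y
    using that by (auto simp: add_mset_commute)
  have "finite (verts G)" using graph by (simp add: multigraph_def)
  then have fin: "finite (h ` verts G)" by simp
  have to_root: "(v, r) \<in> ?A\<^sup>*" if "v \<in> verts G" for v
    using that
  \<comment> \<open>Real heights are not well-founded, so the induction counts the finitely many
    height values below that of \<open>v\<close>. The height of \<open>r\<close> is never compared: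
    descent simply stops there.\<close>
  proof (induction "card {x \<in> h ` verts G. x < h v}" arbitrary: v rule: less_induct)
    case less
    show ?case
    proof (cases "v = r")
      case False
      then have v: "v \<in> verts G - {r}" using less.prems by simp
      have vq: "(v, q v) \<in> ?A"
        using v ends_parent_edge[OF v] by (auto simp: parent_tree_def)
      show ?thesis
      proof (cases "q v = r")
        case True
        then show ?thesis using vq by auto
      next
        case ne: False
        then have lt: "h (q v) < h v" using descent[OF v] by simp
        have "{x \<in> h ` verts G. x < h (q v)} \<subset> {x \<in> h ` verts G. x < h v}"
          using lt parent_in_verts[OF v] by auto
        then have "card {x \<in> h ` verts G. x < h (q v)} < card {x \<in> h ` verts G. x < h v}"
          using fin by (intro psubset_card_mono) auto
        then have "(q v, r) \<in> ?A\<^sup>*" using less.hyps parent_in_verts[OF v] by blast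
        then show ?thesis using vq by (meson converse_rtrancl_into_rtrancl)
      qed
    qed simp
  qed
  have "sym ?A" using sym by (rule symI)
  then have "sym (?A\<^sup>*)" by (rule sym_rtrancl)
  then have "(u, v) \<in> ?A\<^sup>*" if "u \<in> verts G" "v \<in> verts G" for u v
    using that to_root by (meson rtrancl_trans symD)
  moreover have "multigraph parent_tree" using subgraph_parent_tree by (simp add: subgraph_def)
  ultimately show ?thesis
    unfolding connected_graph_def using path_graph_of_walk[of parent_tree] root by (auto simp: parent_tree_def)
qed

text \<open>Counting shows that a cycle would contain the parent edge, hence the parent, of each of its
  vertices.\<close>

lemma acyclic_parent_tree: "\<nexists>C. subgraph C parent_tree \<and> cycle_graph C"
proof
  assume "\<exists>C. subgraph C parent_tree \<and> cycle_graph C"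
  then obtain C vs es where C: "subgraph C parent_tree" and vs: "vs \<noteq> []" "length vs = length es"
      "distinct vs" "distinct es" "verts C = set vs" "edges C = set es"
    unfolding cycle_graph_def by metis
  have sub: "set vs \<subseteq> verts G" "set es \<subseteq> p ` (verts G - {r})" "ends C = ends G"
    using C vs by (auto simp: subgraph_def parent_tree_def)
  have ends: "set_mset (ends G e) \<subseteq> set vs" if "e \<in> set es" for e
    using multigraph.ends_in_verts[of C e] C that vs(5,6) sub(3) by (simp add: subgraph_def)
  define Y where "Y = {y \<in> set vs - {r}. p y \<in> set es}"
  have "set es \<subseteq> p ` Y"
  proof
    fix e assume e: "e \<in> set es"
    then obtain y where y: "y \<in> verts G - {r}" "e = p y" using sub by blast
    then have "y \<in> set vs" using ends[OF e] ends_parent_edge[OF y(1)] by simp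
    then show "e \<in> p ` Y" using y e by (auto simp: Y_def)
  qed
  moreover have "finite Y" by (simp add: Y_def)
  ultimately have "card (set es) \<le> card Y" by (rule surj_card_le[rotated])
  then have "card (set vs) \<le> card Y" using vs by (simp add: distinct_card)
  then have Y: "Y = set vs" by (intro card_seteq) (auto simp: Y_def)
  \<comment> \<open>A vertex of least height on the cycle has its parent on the cycle as well, and
    that parent is not \<open>r\<close> and hence strictly lower.\<close>
  have "finite (h ` set vs)" "h ` set vs \<noteq> {}" using vs(1) by auto
  then have "Min (h ` set vs) \<in> h ` set vs" by (rule Min_in)
  then obtain y where y: "y \<in> set vs" "h y = Min (h ` set vs)" by auto
  then have "y \<in> Y" using Y by simp
  then have *: "y \<in> verts G - {r}" "p y \<in> set es" using sub by (auto simp: Y_def)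
  then have "q y \<in> set vs" using ends[OF *(2)] ends_parent_edge[OF *(1)] by simp
  moreover from this have "q y \<noteq> r" using Y by (auto simp: Y_def)
  then have "h (q y) < h y" using descent[OF *(1)] by simp
  moreover have "h y \<le> h (q y)" using calculation(1) y(2) by simp
  ultimately show False by simp
qed

lemma spanning_tree_parent_tree: "spanning_tree parent_tree G"
  using subgraph_parent_tree connected_parent_tree acyclic_parent_tree
  by (simp add: spanning_tree_def tree_def subgraph_def parent_tree_def)

text \<open>A path starting at \<open>r\<close> runs from parent to child at every step, so a weight
  that grows away from the root is largest on the last edge, the parent edge of \<open>v\<close>.
  The weight \<open>\<kappa>\<close> is generic because both heights and chain indices are compared
  in this way.\<close>

lemma path_edge_le:
  fixes \<kappa> :: "'e \<Rightarrow> 'a::preorder"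
  assumes P: "subgraph P parent_tree" "path_graph P r v" and e: "e \<in> edges P"
    and mono: "\<And>x. x \<in> verts G - {r} \<Longrightarrow> q x \<noteq> r \<Longrightarrow> \<kappa> (p (q x)) \<le> \<kappa> (p x)"
  shows "v \<noteq> r" "\<kappa> e \<le> \<kappa> (p v)"
proof -
  obtain vs es where vs: "length vs = Suc (length es)" "distinct vs" "hd vs = r" "last vs = v"
      "verts P = set vs" "edges P = set es"
      "\<And>i. i < length es \<Longrightarrow> ends P (es ! i) = {#vs ! i, vs ! Suc i#}"
    using P(2) unfolding path_graph_def by metis
  have "vs \<noteq> []" using vs(1) by auto
  then have r: "vs ! 0 = r" and v: "vs ! length es = v"
    using vs by (auto simp: hd_conv_nth last_conv_nth)
  have sub: "set vs \<subseteq> verts G" "set es \<subseteq> p ` (verts G - {r})" "ends P = ends G"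
    using P vs by (auto simp: subgraph_def parent_tree_def)
  have ne: "vs ! i \<noteq> vs ! j" if "i < length vs" "j < length vs" "i \<noteq> j" for i j
    using vs(2) that by (simp add: nth_eq_iff_index_eq)
  have parent: "es ! i = p (vs ! Suc i) \<and> vs ! i = q (vs ! Suc i)" if "i < length es" for i
    using that
  proof (induction i)
    case i: (0)
    then obtain x where x: "x \<in> verts G - {r}" "es ! 0 = p x" using sub(2) nth_mem by blast
    have "{#vs ! 0, vs ! Suc 0#} = {#x, q x#}"
      using vs(7)[OF i] sub(3) x ends_parent_edge by metis
    then show ?case using x r by (auto simp: add_eq_conv_ex)
  next
    case (Suc i)
    then obtain x where x: "x \<in> verts G - {r}" "es ! Suc i = p x" using sub(2) nth_mem by blast
    have *: "{#vs ! Suc i, vs ! Suc (Suc i)#} = {#x, q x#}"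
      using vs(7)[OF Suc.prems] sub(3) x ends_parent_edge by metis
    \<comment> \<open>By induction the previous edge is the parent edge of
      \<open>vs ! Suc i\<close>. Were the next edge that same parent edge, it would lead back to
      \<open>vs ! i\<close>.\<close>
    have "x \<noteq> vs ! Suc i"
    proof
      assume "x = vs ! Suc i"
      then have "vs ! Suc (Suc i) = vs ! i" using * Suc by simp
      then show False using ne[of "Suc (Suc i)" i] Suc.prems vs(1) by simp
    qed
    then show ?case using * x by (auto simp: add_eq_conv_ex)
  qed
  from e obtain i where i: "i < length es" "es ! i = e" using vs(6) by (metis in_set_conv_nth)
  then show "v \<noteq> r" using ne[of 0 "length es"] r v vs(1) by (cases "length es") auto
  have "\<kappa> (p (vs ! Suc i)) \<le> \<kappa> (p (vs ! length es))"
  proof -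
    have "Suc i \<le> length es" using i by simp
    then show ?thesis
    proof (induction rule: inc_induct)
      case (step n)
      then have "vs ! Suc n \<in> verts G - {r}" "vs ! n \<noteq> r"
        using sub(1) vs(1) ne[of 0 "Suc n"] ne[of 0 n] r by (auto simp: subset_iff)
      then have "\<kappa> (p (vs ! n)) \<le> \<kappa> (p (vs ! Suc n))"
        using mono[of "vs ! Suc n"] parent[of n] step.hyps by simp
      then show ?case using step.IH order_trans by blast
    qed simp
  qed
  then show "\<kappa> e \<le> \<kappa> (p v)" using parent[OF i(1)] i(2) v by simp
qed

end

section \<open>Heights along ears\<close>

lemma inj_on_shift:
  fixes w :: "nat \<Rightarrow> 'a"
  assumes "inj_on w A" "\<And>k. k \<in> B \<Longrightarrow> m + k \<in> A"
  shows "inj_on (\<lambda>k. w (m + k)) B"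
  using assms by (auto simp: inj_on_def) (meson add_left_cancel)

lemma image_reverse:
  fixes w :: "nat \<Rightarrow> 'a" and n :: nat
  shows "(\<lambda>k. w (n - k)) ` {0<..<n} = w ` {0<..<n}"
    and "(\<lambda>k. w (n - k)) ` {0..n} = w ` {0..n}"
    and "(\<lambda>k. w (n - Suc k)) ` {..<n} = w ` {..<n}"
proof -
  have "bij_betw (\<lambda>k. n - k) {0<..<n} {0<..<n}"
    by (rule bij_betwI[of _ _ _ "\<lambda>k. n - k"]) auto
  moreover have "bij_betw (\<lambda>k. n - k) {0..n} {0..n}"
    by (rule bij_betwI[of _ _ _ "\<lambda>k. n - k"]) auto
  moreover have "bij_betw (\<lambda>k. n - Suc k) {..<n} {..<n}"
    by (rule bij_betwI[of _ _ _ "\<lambda>k. n - Suc k"]) auto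
  ultimately show "(\<lambda>k. w (n - k)) ` {0<..<n} = w ` {0<..<n}"
    and "(\<lambda>k. w (n - k)) ` {0..n} = w ` {0..n}"
    and "(\<lambda>k. w (n - Suc k)) ` {..<n} = w ` {..<n}"
    unfolding bij_betw_def by (metis image_image)+
qed

section \<open>Heights with a lower and an upper parent map, and their extension along one
  ear\<close>

locale rooted_incidence =
  fixes en :: "'e \<Rightarrow> 'v multiset" and r :: 'v and cix :: "'e \<Rightarrow> nat"
begin

text \<open>Throughout, \<open>E\<close> is the set of edges met so far, \<open>S\<close> the set of non-root vertices reached, and
  \<open>D\<close> the set of those already completed by a second edge, at the chain of index \<open>t v\<close>; the vertices
  in \<open>S - D\<close> are pending, and both of their parent edges are the same edge. Off \<open>D\<close>, \<open>t\<close> is kept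
  equal to the current index \<open>i\<close>.\<close>

definition branch :: "'e set \<Rightarrow> 'v set \<Rightarrow> 'v set \<Rightarrow> ('v \<Rightarrow> nat) \<Rightarrow> ('e \<Rightarrow> real) \<Rightarrow>
    ('v \<Rightarrow> 'e) \<Rightarrow> ('v \<Rightarrow> 'v) \<Rightarrow> bool" where
  "branch E S D t f p q \<longleftrightarrow>
     (\<forall>v\<in>S. p v \<in> E \<and> en (p v) = {#v, q v#} \<and> (v \<in> D \<longrightarrow> cix (p v) \<le> t v) \<and>
        (q v = r \<or> q v \<in> D \<and> f (p (q v)) < f (p v) \<and> t (q v) \<le> cix (p v)))"

text \<open>The upper parent map is a lower one for the negated heights, so facts about
  \<open>branch\<close> serve both. Injectivity on pending vertices ensures that two distinct
  pending ends of an ear have different heights, one of which can be taken as the bottom.\<close>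

definition bipolar :: "nat \<Rightarrow> 'e set \<Rightarrow> 'v set \<Rightarrow> 'v set \<Rightarrow> ('v \<Rightarrow> nat) \<Rightarrow> ('e \<Rightarrow> real) \<Rightarrow>
    ('v \<Rightarrow> 'e) \<Rightarrow> ('v \<Rightarrow> 'v) \<Rightarrow> ('v \<Rightarrow> 'e) \<Rightarrow> ('v \<Rightarrow> 'v) \<Rightarrow> bool" where
  "bipolar i E S D t f p q p' q' \<longleftrightarrow>
     D \<subseteq> S \<and> r \<notin> S \<and> finite S \<and>
     branch E S D t f p q \<and> branch E S D t (\<lambda>e. - f e) p' q' \<and>
     (\<forall>v\<in>S. f (p v) \<le> f (p' v)) \<and> (\<forall>v\<in>D. f (p v) < f (p' v)) \<and>
     inj_on (\<lambda>v. f (p v)) (S - D) \<and>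
     (\<forall>e\<in>E. cix e \<le> i) \<and> (\<forall>v. t v \<le> i \<and> (v \<notin> D \<longrightarrow> t v = i))"

text \<open>Closed ears are allowed, hence injectivity only at interior positions. They must close
  at the root or at a completed vertex: a pending one has a single parent edge, which leaves no
  interval of heights for the ear.\<close>

definition ear :: "'v set \<Rightarrow> 'v set \<Rightarrow> (nat \<Rightarrow> 'v) \<Rightarrow> (nat \<Rightarrow> 'e) \<Rightarrow> nat \<Rightarrow> bool" where
  "ear S D w c n \<longleftrightarrow>
     0 < n \<and> inj_on w {0<..<n} \<and> inj_on c {..<n} \<and>
     (\<forall>k<n. en (c k) = {#w k, w (Suc k)#}) \<and>
     (\<forall>k\<in>{0<..<n}. w k \<notin> S \<and> w k \<noteq> r) \<and>
     w 0 \<in> insert r S \<and> w n \<in> insert r S \<and> (w 0 = w n \<longrightarrow> w 0 \<in> insert r D)"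

text \<open>When heights increase along the ear, each interior vertex takes the preceding ear edge
  as its lower parent edge. A pending \<open>w n\<close> exchanges its old parent edge for the last
  ear edge, while \<open>w 0\<close> keeps its own. The statement records which parents change, so
  that it can be combined with its mirror image.\<close>

lemma branch_ear:
  assumes B: "branch E S D t f p q" and DS: "D \<subseteq> S" "r \<notin> S" and ear: "ear S D w c n"
    and E: "\<And>e. e \<in> E \<Longrightarrow> cix e \<le> i" and c: "\<And>k. k < n \<Longrightarrow> cix (c k) = i"
    and t: "\<And>v. t v \<le> i" "\<And>v. v \<notin> D \<Longrightarrow> t v = i"
    and f: "\<And>e. e \<in> E \<Longrightarrow> f' e = f e"
    and inc: "\<And>k. Suc k < n \<Longrightarrow> f' (c k) < f' (c (Suc k))"
    and low: "w 0 = r \<or> f (p (w 0)) < f' (c 0)"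
  shows "\<exists>p' q'. branch (E \<union> c ` {..<n}) (S \<union> w ` {0<..<n}) (D \<union> (w ` {0..n} - {r})) t f' p' q' \<and>
    (\<forall>k\<in>{0<..<n}. p' (w k) = c (k - 1)) \<and> (w n \<notin> insert r D \<longrightarrow> p' (w n) = c (n - 1)) \<and>
    (\<forall>v. v \<notin> w ` {0<..<n} \<longrightarrow> v \<noteq> w n \<or> v \<in> insert r D \<longrightarrow> p' v = p v)"
proof -
  note ear = ear[unfolded ear_def]
  \<comment> \<open>Positions whose vertex receives a new parent: the interior ones, and
    \<open>n\<close> exactly when \<open>w n\<close> is pending.\<close>
  define A where "A = (if w n \<in> insert r D then {0<..<n} else {0<..n})"
  have A: "{0<..<n} \<subseteq> A" "A \<subseteq> {0<..n}" "w n \<notin> insert r D \<Longrightarrow> n \<in> A" "n \<in> A \<Longrightarrow> w n \<notin> insert r D"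
    using ear by (auto simp: A_def)
  have injA: "inj_on w A"
  proof (cases "w n \<in> insert r D")
    case False
    have "{0<..n} = insert n {0<..<n}" using ear by auto
    then show ?thesis using False ear by (auto simp: A_def)
  qed (use ear in \<open>simp add: A_def\<close>)
  define ix where "ix = inv_into A w"
  have ix: "ix (w k) = k" if "k \<in> A" for k using injA that by (simp add: ix_def)
  define p' where "p' v = (if v \<in> w ` A then c (ix v - 1) else p v)" for v
  define q' where "q' v = (if v \<in> w ` A then w (ix v - 1) else q v)" for v
  have newp: "p' (w k) = c (k - 1)" "q' (w k) = w (k - 1)" if "k \<in> A" for k
    using that ix by (auto simp: p'_def q'_def)
  have oldp: "p' v = p v" "q' v = q v" if "v \<notin> w ` A" for v
    using that by (auto simp: p'_def q'_def)
  have AD: "w k \<notin> insert r D" if "k \<in> A" for k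
  proof (cases "k = n")
    case True
    then show ?thesis using A(4) that by simp
  next
    case False
    then have "k \<in> {0<..<n}" using A(2) that by auto
    then show ?thesis using ear DS(1) by blast
  qed
  have w0: "w 0 \<notin> w ` A"
  proof
    assume "w 0 \<in> w ` A"
    then obtain k where k: "k \<in> A" "w 0 = w k" by auto
    show False
    proof (cases "k = n")
      case True
      then show ?thesis using k ear AD by auto
    next
      case False
      then have "k \<in> {0<..<n}" using A(2) k(1) by auto
      then have "w k \<notin> insert r S" using ear by blast
      then show ?thesis using k(2) ear by simp
    qed
  qed
  let ?S = "S \<union> w ` {0<..<n}" and ?D = "D \<union> (w ` {0..n} - {r})"
  have "p' v \<in> E \<union> c ` {..<n} \<and> en (p' v) = {#v, q' v#} \<and> (v \<in> ?D \<longrightarrow> cix (p' v) \<le> t v) \<and>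
        (q' v = r \<or> q' v \<in> ?D \<and> f' (p' (q' v)) < f' (p' v) \<and> t (q' v) \<le> cix (p' v))"
    if v: "v \<in> ?S" for v
  proof (cases "v \<in> w ` A")
    case True
    then obtain k where k: "k \<in> A" "v = w k" by auto
    then have "0 < k" "k \<le> n" using A(2) by auto
    then have k': "0 < k" "k - 1 < n" "k \<le> n" by auto
    have "en (c (k - 1)) = {#w k, w (k - 1)#}" using ear k' by (auto simp: add_mset_commute)
    moreover have "t v = i" using t(2) AD k by simp
    \<comment> \<open>The parent edge of the preceding vertex is an old edge, bounded by
      \<open>low\<close>, if that vertex is \<open>w 0\<close>, and otherwise the preceding ear
      edge.\<close>
    moreover have "w (k - 1) = r \<or> f' (p' (w (k - 1))) < f' (c (k - 1))"
    proof (cases "k = 1")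
      case True
      have "w 0 = r \<or> p (w 0) \<in> E" using B ear unfolding branch_def by auto
      then show ?thesis using low oldp[OF w0] f True by auto
    next
      case False
      then have "k - 1 \<in> A" using k' A(1) by auto
      then have "p' (w (k - 1)) = c (k - 2)" using newp by (simp add: numeral_2_eq_2)
      then show ?thesis using inc[of "k - 2"] False k' by (simp add: numeral_2_eq_2 Suc_diff_Suc)
    qed
    moreover have "w (k - 1) = r \<or> w (k - 1) \<in> ?D" using k' by auto
    ultimately show ?thesis using newp[OF k(1)] k k' c t(1) by auto
  next
    case False
    then have vS: "v \<in> S" using v A(1) by auto
    then have b: "p v \<in> E" "en (p v) = {#v, q v#}" "v \<in> D \<Longrightarrow> cix (p v) \<le> t v"
      "q v = r \<or> q v \<in> D \<and> f (p (q v)) < f (p v) \<and> t (q v) \<le> cix (p v)"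
      using B by (auto simp: branch_def)
    have "cix (p v) \<le> t v" using b(1,3) E t(2) by (cases "v \<in> D") auto
    \<comment> \<open>A parent other than \<open>r\<close> is completed, whereas only new and
      pending vertices change parent edges; so the descent of old vertices is undisturbed.\<close>
    moreover have "p' (q v) = p (q v) \<and> p (q v) \<in> E" if "q v \<in> D"
    proof -
      have "q v \<notin> w ` A" using that by (auto dest: AD)
      moreover have "q v \<in> S" using that DS(1) by blast
      then have "p (q v) \<in> E" using B by (simp add: branch_def)
      ultimately show ?thesis using oldp(1) by simp
    qed
    ultimately show ?thesis using oldp[OF False] b f by auto
  qed
  then have "branch (E \<union> c ` {..<n}) ?S ?D t f' p' q'" unfolding branch_def by blast
  moreover have "p' v = p v" if "v \<notin> w ` {0<..<n}" "v \<noteq> w n \<or> v \<in> insert r D" for v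
  proof -
    have "v \<notin> w ` A"
    proof
      assume "v \<in> w ` A"
      then obtain k where k: "k \<in> A" "v = w k" by auto
      then have "k = n" using that(1) A(2) by (force simp: image_iff)
      then show False using k AD[of n] that(2) by auto
    qed
    then show ?thesis by (rule oldp)
  qed
  ultimately show ?thesis
    using newp(1) A(1,3) by blast
qed

lemma ear_reverse:
  assumes "ear S D w c n"
  shows "ear S D (\<lambda>k. w (n - k)) (\<lambda>k. c (n - Suc k)) n"
proof -
  have "inj_on (\<lambda>k. w (n - k)) {0<..<n}"
  proof (rule inj_onI)
    fix j k assume "j \<in> {0<..<n}" "k \<in> {0<..<n}" "w (n - j) = w (n - k)"
    moreover then have "n - j = n - k"
      using assms by (intro inj_onD[of w "{0<..<n}"]) (auto simp: ear_def)
    ultimately show "j = k" by auto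
  qed
  moreover have "inj_on (\<lambda>k. c (n - Suc k)) {..<n}"
  proof (rule inj_onI)
    fix j k assume "j \<in> {..<n}" "k \<in> {..<n}" "c (n - Suc j) = c (n - Suc k)"
    moreover then have "n - Suc j = n - Suc k"
      using assms by (intro inj_onD[of c "{..<n}"]) (auto simp: ear_def)
    ultimately show "j = k" by auto
  qed
  moreover have "en (c (n - Suc k)) = {#w (n - k), w (n - Suc k)#}" if "k < n" for k
  proof -
    have "en (c (n - Suc k)) = {#w (n - Suc k), w (Suc (n - Suc k))#}"
      using assms that unfolding ear_def by auto
    then show ?thesis using that by (simp add: Suc_diff_Suc add_mset_commute)
  qed
  ultimately show ?thesis using assms unfolding ear_def by auto
qed

text \<open>Any interval from \<open>y\<close> to \<open>z\<close> above the lower edge of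
  \<open>w 0\<close> and below the upper edge of \<open>w n\<close> has room for heights increasing
  along the ear.\<close>

lemma bipolar_ear_oriented:
  assumes B: "bipolar i E S D t f p q p' q'" and ear: "ear S D w c n"
    and c: "\<And>k. k < n \<Longrightarrow> cix (c k) = i \<and> c k \<notin> E"
    and low: "w 0 = r \<or> f (p (w 0)) < y" and yz: "y < z" and high: "w n = r \<or> z < f (p' (w n))"
  shows "\<exists>f p q p' q'.
    bipolar i (E \<union> c ` {..<n}) (S \<union> w ` {0<..<n}) (D \<union> (w ` {0..n} - {r})) t f p q p' q'"
proof -
  note earD = ear[unfolded ear_def]
  let ?E = "E \<union> c ` {..<n}" and ?S = "S \<union> w ` {0<..<n}" and ?D = "D \<union> (w ` {0..n} - {r})"
  have n: "0 < n" and injc: "inj_on c {..<n}" using earD by auto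
  have BD: "D \<subseteq> S" "r \<notin> S" "finite S" "branch E S D t f p q"
    "branch E S D t (\<lambda>e. - f e) p' q'" "\<And>v. v \<in> S \<Longrightarrow> f (p v) \<le> f (p' v)"
    "\<And>v. v \<in> D \<Longrightarrow> f (p v) < f (p' v)"
    "inj_on (\<lambda>v. f (p v)) (S - D)" "\<And>e. e \<in> E \<Longrightarrow> cix e \<le> i" "\<And>v. t v \<le> i"
    "\<And>v. v \<notin> D \<Longrightarrow> t v = i"
    using B by (auto simp: bipolar_def)
  have pE: "p v \<in> E" "p' v \<in> E" if "v \<in> S" for v
    using BD(4,5) that by (auto simp: branch_def)
  have ci: "cix (c k) = i" "c k \<notin> E" if "k < n" for k using c that by auto
  \<comment> \<open>Equally spaced heights starting with exactly \<open>y\<close> on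
    \<open>c 0\<close> and staying below \<open>z\<close>.\<close>
  define g where
    "g e = (if e \<in> c ` {..<n} then y + (z - y) * (inv_into {..<n} c e / n) else f e)" for e
  have gc: "g (c k) = y + (z - y) * (k / n)" if "k < n" for k
    using that injc by (simp add: g_def)
  have gE: "g e = f e" if "e \<in> E" for e
    using that ci(2) by (auto simp: g_def)
  have g_mono: "g (c j) < g (c k)" if "j < k" "k < n" for j k
    using that yz n by (simp add: gc divide_strict_right_mono)
  have g_low: "y \<le> g (c k)" and g_high: "g (c k) < z" if "k < n" for k
  proof -
    show "y \<le> g (c k)" using that yz by (simp add: gc)
    have "(z - y) * (k / n) < (z - y) * 1"
      using that yz by (intro mult_strict_left_mono) auto
    then show "g (c k) < z" using gc[OF that] by simp
  qed
  have "w 0 = r \<or> f (p (w 0)) < g (c 0)" using low g_low[OF n] by auto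
  then obtain p1 q1 where 1: "branch ?E ?S ?D t g p1 q1"
    "\<And>k. k \<in> {0<..<n} \<Longrightarrow> p1 (w k) = c (k - 1)"
    "w n \<notin> insert r D \<Longrightarrow> p1 (w n) = c (n - 1)"
    "\<And>v. v \<notin> w ` {0<..<n} \<Longrightarrow> v \<noteq> w n \<or> v \<in> insert r D \<Longrightarrow> p1 v = p v"
    using branch_ear[OF BD(4,1,2) ear BD(9) ci(1) BD(10,11), where f' = g] gE g_mono[OF lessI] by blast
  \<comment> \<open>The ear read backwards with negated heights is again increasing, and the same
    lemma yields the upper parent map.\<close>
  let ?w = "\<lambda>k. w (n - k)" and ?c = "\<lambda>k. c (n - Suc k)"
  have "?w 0 = r \<or> - f (p' (?w 0)) < - g (?c 0)"
    using high g_high[of "n - 1"] n by auto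
  moreover have "- g (?c k) < - g (?c (Suc k))" if "Suc k < n" for k
    using g_mono[of "n - Suc (Suc k)" "n - Suc k"] that by simp
  moreover have "- g e = - f e" if "e \<in> E" for e using gE[OF that] by simp
  moreover have "cix (?c k) = i" if "k < n" for k using ci(1)[of "n - Suc k"] that by simp
  ultimately have "\<exists>p2 q2. branch (E \<union> ?c ` {..<n}) (S \<union> ?w ` {0<..<n}) (D \<union> (?w ` {0..n} - {r})) t
      (\<lambda>e. - g e) p2 q2 \<and>
    (\<forall>k\<in>{0<..<n}. p2 (?w k) = ?c (k - 1)) \<and> (?w n \<notin> insert r D \<longrightarrow> p2 (?w n) = ?c (n - 1)) \<and>
    (\<forall>v. v \<notin> ?w ` {0<..<n} \<longrightarrow> v \<noteq> ?w n \<or> v \<in> insert r D \<longrightarrow> p2 v = p' v)"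
    by (intro branch_ear[OF BD(5,1,2) ear_reverse[OF ear] BD(9) _ BD(10,11)]) auto
  then obtain p2 q2 where 2: "branch ?E ?S ?D t (\<lambda>e. - g e) p2 q2"
    "\<And>k. k \<in> {0<..<n} \<Longrightarrow> p2 (w (n - k)) = c (n - Suc (k - 1))"
    "w 0 \<notin> insert r D \<Longrightarrow> p2 (w 0) = c (n - Suc (n - 1))"
    "\<And>v. v \<notin> w ` {0<..<n} \<Longrightarrow> v \<noteq> w 0 \<or> v \<in> insert r D \<Longrightarrow> p2 v = p' v"
    unfolding image_reverse diff_self_eq_0 by blast
  have p2: "p2 (w k) = c k" if "k \<in> {0<..<n}" for k
    using 2(2)[of "n - k"] that by (auto simp: Suc_diff_Suc)
  have p20: "w 0 \<notin> insert r D \<Longrightarrow> p2 (w 0) = c 0" using 2(3) n by simp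
  have intS: "w k \<notin> insert r S" if "k \<in> {0<..<n}" for k using earD that by blast
  \<comment> \<open>Interior vertices lie between consecutive ear edges, and completed ones keep
    both parent edges. A pending \<open>w 0\<close> keeps its lower edge and gets \<open>c 0\<close>
    as upper edge; a pending \<open>w n\<close> keeps its upper edge and gets the last ear edge as
    lower edge.\<close>
  have strict: "g (p1 v) < g (p2 v)" if v: "v \<in> ?D" for v
  proof -
    consider k where "k \<in> {0<..<n}" "v = w k" | "v \<in> D"
      | "v = w 0" "v \<notin> insert r D" | "v = w n" "v \<notin> insert r D"
    proof -
      have "v \<in> D \<or> (\<exists>k\<in>{0..n}. v = w k \<and> v \<noteq> r)" using v by blast
      moreover have "k = 0 \<or> k = n \<or> k \<in> {0<..<n}" if "k \<in> {0..n}" for k using that by auto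
      ultimately show ?thesis using that by blast
    qed
    then show ?thesis
    proof cases
      case 1
      then show ?thesis using \<open>\<And>k. k \<in> {0<..<n} \<Longrightarrow> p1 (w k) = c (k - 1)\<close>[of k] p2[of k] g_mono[of "k - 1" k] by auto
    next
      case v: 2
      then have "v \<notin> w ` {0<..<n}" using intS BD(1) by blast
      then have "p1 v = p v" "p2 v = p' v" using 1(4) 2(4) v by auto
      then show ?thesis using BD(7)[OF v] pE v BD(1) gE by (metis subsetD)
    next
      case v: 3
      then have vS: "v \<in> S" using earD by auto
      then have "v \<notin> w ` {0<..<n}" using intS by blast
      moreover have "w 0 \<noteq> w n" using v earD by auto
      ultimately have "p1 v = p v" using 1(4) v by auto
      then show ?thesis using p20 v low g_low[OF n] gE pE(1)[OF vS] by auto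
    next
      case v: 4
      then have vS: "v \<in> S" using earD by auto
      then have "v \<notin> w ` {0<..<n}" using intS by blast
      moreover have "w 0 \<noteq> w n" using v earD by auto
      ultimately have "p2 v = p' v" using 2(4) v by auto
      then show ?thesis using 1(3) v high g_high[of "n - 1"] n gE pE(2)[OF vS] by auto
    qed
  qed
  \<comment> \<open>Vertices still pending afterwards were pending before and are not on the ear, so
    injectivity is inherited.\<close>
  have old: "p1 v = p v" "p2 v = p' v" "v \<in> S - D" if "v \<in> ?S - ?D" for v
  proof -
    have "v \<noteq> r" using that intS BD(2) by blast
    then have "v \<notin> w ` {0..n}" using that by auto
    then have "v \<notin> w ` {0<..<n}" "v \<noteq> w 0" "v \<noteq> w n" by auto
    then show "p1 v = p v" "p2 v = p' v" "v \<in> S - D" using 1(4) 2(4) that by auto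
  qed
  have "g (p1 v) \<le> g (p2 v)" if "v \<in> ?S" for v
  proof (cases "v \<in> ?D")
    case True
    then show ?thesis using strict[of v] by simp
  next
    case False
    then have "v \<in> ?S - ?D" using that by blast
    then show ?thesis using old[of v] BD(6)[of v] gE pE[of v] by auto
  qed
  moreover have "inj_on (\<lambda>v. g (p1 v)) (?S - ?D)"
  proof (rule inj_onI)
    fix u v assume uv: "u \<in> ?S - ?D" "v \<in> ?S - ?D" "g (p1 u) = g (p1 v)"
    then have "f (p u) = f (p v)" using old[of u] old[of v] gE pE(1)[of u] pE(1)[of v] by auto
    then show "u = v" using inj_onD[OF BD(8)] old(3)[of u] old(3)[of v] uv by blast
  qed
  moreover have "?D \<subseteq> ?S"
  proof -
    have "w k \<in> insert r ?S" if "k \<in> {0..n}" for k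
    proof -
      have "k = 0 \<or> k = n \<or> k \<in> {0<..<n}" using that by auto
      then show ?thesis using earD by blast
    qed
    then show ?thesis using BD(1) by blast
  qed
  moreover have "r \<notin> ?S" using intS BD(2) by blast
  moreover have "\<forall>e\<in>?E. cix e \<le> i" using ci(1) BD(9) by auto
  moreover have "finite ?S" using BD(3) by simp
  moreover have "\<forall>v. t v \<le> i \<and> (v \<notin> ?D \<longrightarrow> t v = i)" using BD(10,11) by simp
  ultimately have "bipolar i ?E ?S ?D t g p1 q1 p2 q2"
    unfolding bipolar_def using 1(1) 2(1) strict by (intro conjI ballI) simp_all
  then show ?thesis by blast
qed

text \<open>At least one orientation of the ear fits between its ends: otherwise both ends carry a single
  edge, at the same height, which injectivity on pending vertices excludes.\<close>

lemma bipolar_ear: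
  assumes B: "bipolar i E S D t f p q p' q'" and ear: "ear S D w c n"
    and c: "\<And>k. k < n \<Longrightarrow> cix (c k) = i \<and> c k \<notin> E"
  shows "\<exists>f p q p' q'.
    bipolar i (E \<union> c ` {..<n}) (S \<union> w ` {0<..<n}) (D \<union> (w ` {0..n} - {r})) t f p q p' q'"
proof -
  \<comment> \<open>There is room for an ear rising from \<open>u\<close> to \<open>v\<close>; an
    end at the root imposes no bound.\<close>
  let ?fits = "\<lambda>u v. \<exists>y z. (u = r \<or> f (p u) < y) \<and> y < z \<and> (v = r \<or> z < f (p' v))"
  have fits: "?fits u v" if "u = r \<or> v = r \<or> f (p u) < f (p' v)" for u v
  proof -
    consider "u = r" "v = r" | "u = r" "v \<noteq> r" | "u \<noteq> r" "v = r" | "f (p u) < f (p' v)"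
      using \<open>u = r \<or> v = r \<or> f (p u) < f (p' v)\<close> by blast
    then show ?thesis
    proof cases
      case 1
      then show ?thesis by (intro exI[of _ 0] exI[of _ 1]) simp
    next
      case 2
      then show ?thesis by (intro exI[of _ "f (p' v) - 2"] exI[of _ "f (p' v) - 1"]) simp
    next
      case 3
      then show ?thesis by (intro exI[of _ "f (p u) + 1"] exI[of _ "f (p u) + 2"]) simp
    next
      case 4
      then show ?thesis by (meson dense)
    qed
  qed
  have BD: "\<And>v. v \<in> S \<Longrightarrow> f (p v) \<le> f (p' v)" "\<And>v. v \<in> D \<Longrightarrow> f (p v) < f (p' v)"
    "inj_on (\<lambda>v. f (p v)) (S - D)"
    using B by (auto simp: bipolar_def)
  let ?u = "w 0" and ?v = "w n"
  have uv: "?u \<in> insert r S" "?v \<in> insert r S" "?u = ?v \<longrightarrow> ?u \<in> insert r D"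
    using ear by (auto simp: ear_def)
  have "?u = r \<or> ?v = r \<or> f (p ?u) < f (p' ?v) \<or> f (p ?v) < f (p' ?u)"
  proof (rule ccontr)
    assume *: "\<not> ?thesis"
    then have S: "?u \<in> S" "?v \<in> S" using uv by auto
    then have eq: "f (p ?u) = f (p' ?u)" "f (p ?v) = f (p' ?v)" "f (p ?u) = f (p ?v)"
      using * BD(1)[of ?u] BD(1)[of ?v] by linarith+
    then have "?u \<in> S - D" "?v \<in> S - D" using BD(2)[of ?u] BD(2)[of ?v] S by auto
    then show False using inj_onD[OF BD(3) eq(3)] uv(3) * by auto
  qed
  then consider "?fits ?u ?v" | "?fits ?v ?u" using fits by blast
  then show ?thesis
  proof cases
    case 1
    then show ?thesis using bipolar_ear_oriented[OF B ear c] by blast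
  next
    case 2
    let ?w = "\<lambda>k. w (n - k)" and ?c = "\<lambda>k. c (n - Suc k)"
    obtain y z where "?w 0 = r \<or> f (p (?w 0)) < y" "y < z" "?w n = r \<or> z < f (p' (?w n))"
      using 2 by auto
    moreover have "cix (?c k) = i \<and> ?c k \<notin> E" if "k < n" for k using c[of "n - Suc k"] that by simp
    ultimately show ?thesis
      using bipolar_ear_oriented[OF B ear_reverse[OF ear], of y z] unfolding image_reverse by blast
  qed
qed

section \<open>Growth by walks, pendant edges and discarded chains\<close>

definition orientable :: "nat \<Rightarrow> 'e set \<Rightarrow> 'v set \<Rightarrow> 'v set \<Rightarrow> ('v \<Rightarrow> nat) \<Rightarrow> bool" where
  "orientable i E S D t \<longleftrightarrow> (\<exists>f p q p' q'. bipolar i E S D t f p q p' q')"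

lemma orientable_ear:
  assumes "orientable i E S D t" "ear S D w c n" "\<And>k. k < n \<Longrightarrow> cix (c k) = i \<and> c k \<notin> E"
  shows "orientable i (E \<union> c ` {..<n}) (S \<union> w ` {0<..<n}) (D \<union> (w ` {0..n} - {r})) t"
  using assms bipolar_ear unfolding orientable_def by blast

text \<open>A chain may run through old vertices, so it is cut there into ears.\<close>

lemma orientable_walk:
  assumes "orientable i E S D t" "0 < n" "inj_on c {..<n}" "inj_on w {..<n}" "inj_on w {0<..n}"
    and "\<And>k. k < n \<Longrightarrow> en (c k) = {#w k, w (Suc k)#}"
    and "w 0 \<in> insert r S" "w n \<in> insert r S" "w 0 = w n \<Longrightarrow> w 0 \<in> insert r D"
    and "\<And>k. k < n \<Longrightarrow> cix (c k) = i \<and> c k \<notin> E"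
  shows "orientable i (E \<union> c ` {..<n}) (S \<union> (w ` {0..n} - {r})) (D \<union> (w ` {0..n} - {r})) t"
  using assms
proof (induction n arbitrary: w c E S D rule: less_induct)
  case (less n)
  \<comment> \<open>The first return of the walk to the root or to an old vertex ends the first
    ear.\<close>
  define m where "m = (LEAST m. 0 < m \<and> w m \<in> insert r S)"
  have m: "0 < m" "w m \<in> insert r S"
    using LeastI[of "\<lambda>m. 0 < m \<and> w m \<in> insert r S" n] less.prems(2,8) unfolding m_def by auto
  have mn: "m \<le> n" unfolding m_def using less.prems(2,8) by (intro Least_le) auto
  have int: "w k \<notin> insert r S" if "k \<in> {0<..<m}" for k
    using not_less_Least[of k "\<lambda>m. 0 < m \<and> w m \<in> insert r S"] that unfolding m_def by auto
  \<comment> \<open>Only a cycle that meets old vertices nowhere else gives a closed ear, and then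
    the ear is the whole walk.\<close>
  have closed: "w 0 = w m \<Longrightarrow> m = n"
    using inj_onD[OF less.prems(4), of 0 m] m(1) mn by (cases "m = n") auto
  have "inj_on w {0<..<m}" by (rule inj_on_subset[OF less.prems(5)]) (use mn in auto)
  moreover have "inj_on c {..<m}" by (rule inj_on_subset[OF less.prems(3)]) (use mn in auto)
  ultimately have "ear S D w c m"
    unfolding ear_def using m mn int closed less.prems(6,7,9) by auto
  then have step: "orientable i (E \<union> c ` {..<m}) (S \<union> w ` {0<..<m}) (D \<union> (w ` {0..m} - {r})) t"
    using less.prems(10) mn by (intro orientable_ear[OF less.prems(1)]) auto
  have S: "S \<union> w ` {0<..<m} = S \<union> (w ` {0..m} - {r})" (is "?L = ?R")
  proof
    show "?L \<subseteq> ?R" using int by fastforce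
    have "w k \<in> insert r ?L" if "k \<in> {0..m}" for k
    proof -
      have "k = 0 \<or> k = m \<or> k \<in> {0<..<m}" using that by auto
      then show ?thesis using m(2) less.prems(7) by blast
    qed
    then show "?R \<subseteq> ?L" by blast
  qed
  show ?case
  proof (cases "m = n")
    case True
    then show ?thesis using step S by simp
  next
    case False
    then have lt: "m < n" using mn by simp
    let ?w = "\<lambda>k. w (m + k)" and ?c = "\<lambda>k. c (m + k)"
    let ?E = "E \<union> c ` {..<m}" and ?S = "S \<union> (w ` {0..m} - {r})" and ?D = "D \<union> (w ` {0..m} - {r})"
    have inj: "inj_on ?c {..<n - m}" "inj_on ?w {..<n - m}" "inj_on ?w {0<..n - m}"
      by (rule inj_on_shift[OF less.prems(3)], simp, rule inj_on_shift[OF less.prems(4)], simp,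
          rule inj_on_shift[OF less.prems(5)], auto)
    \<comment> \<open>The remaining walk is never closed, which makes the condition on coinciding
      ends vacuous in the recursion.\<close>
    have ne: "?w 0 \<noteq> ?w (n - m)"
      using inj_onD[OF less.prems(5), of m n] m(1) lt by auto
    have new: "cix (?c k) = i \<and> ?c k \<notin> ?E" if k: "k < n - m" for k
    proof -
      have "c (m + k) \<noteq> c j" if "j < m" for j
        using inj_onD[OF less.prems(3), of "m + k" j] that k lt by fastforce
      moreover have "m + k < n" using k by simp
      ultimately show ?thesis using less.prems(10) by auto
    qed
    have "orientable i (?E \<union> ?c ` {..<n - m}) (?S \<union> (?w ` {0..n - m} - {r}))
        (?D \<union> (?w ` {0..n - m} - {r})) t"
    proof (rule less.IH[where w = ?w and c = ?c])
      show "n - m < n" "0 < n - m" using m(1) lt by auto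
      show "orientable i ?E ?S ?D t" using step unfolding S .
      show "en (?c k) = {#?w k, ?w (Suc k)#}" if "k < n - m" for k
        using less.prems(6)[of "m + k"] that by simp
      show "?w 0 \<in> insert r ?S" "?w (n - m) \<in> insert r ?S" using m(2) less.prems(8) lt by auto
    qed (use inj ne new in blast)+
    moreover have "?c ` {..<n - m} = c ` {m..<n}"
      using image_add_atLeastLessThan[of m 0 "n - m"] lt image_image[of c "(+) m" "{0..<n - m}"]
      by (simp add: lessThan_atLeast0)
    moreover have "?w ` {0..n - m} = w ` {m..n}"
      using image_add_atLeastAtMost[of m 0 "n - m"] lt image_image[of w "(+) m" "{0..n - m}"] by simp
    moreover have "{..<m} \<union> {m..<n} = {..<n}" "{0..m} \<union> {m..n} = {0..n}" using lt by auto
    ultimately show ?thesis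
      by (metis Un_Diff Un_assoc image_Un)
  qed
qed

text \<open>The height of the new edge must avoid finitely many values to keep pending vertices apart.\<close>

lemma orientable_pendant:
  assumes "orientable i E S D t" "u \<in> insert r D" "v \<notin> insert r S" "en e = {#u, v#}"
    and "cix e = i" "e \<notin> E"
  shows "orientable i (insert e E) (insert v S) D t"
proof -
  obtain f p q p' q' where B: "bipolar i E S D t f p q p' q'"
    using assms(1) unfolding orientable_def by blast
  \<comment> \<open>The new edge becomes both parent edges of \<open>v\<close>, so its height must
    lie strictly between those of the two parent edges of the completed vertex
    \<open>u\<close>.\<close>
  have "\<exists>y z. y < z \<and> (u = r \<or> f (p u) \<le> y \<and> z \<le> f (p' u))"
  proof (cases "u = r")
    case False
    then have "f (p u) < f (p' u)" using assms(2) B by (simp add: bipolar_def)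
    then show ?thesis by blast
  next
    case True
    then show ?thesis by (intro exI[of _ 0] exI[of _ 1]) simp
  qed
  then obtain y z where yz: "y < z" "u = r \<or> f (p u) \<le> y \<and> z \<le> f (p' u)" by blast
  have "finite ((\<lambda>v. f (p v)) ` S)" using B by (simp add: bipolar_def)
  then have "infinite ({y<..<z} - (\<lambda>v. f (p v)) ` S)" using yz(1) by simp
  then obtain x where x: "x \<in> {y<..<z} - (\<lambda>v. f (p v)) ` S"
    using infinite_imp_nonempty by blast
  let ?f = "f(e := x)"
  have pE: "p w \<in> E" "p' w \<in> E" "p w \<noteq> e" "p' w \<noteq> e" if "w \<in> S" for w
    using B that assms(6) by (auto simp: bipolar_def branch_def)
  have DS: "D \<subseteq> S" "r \<notin> S" and vD: "v \<notin> D" "t v = i" "t u \<le> i" "u \<noteq> v"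
    using B assms(2,3) by (auto simp: bipolar_def)
  have DSD: "w \<in> D \<Longrightarrow> w \<in> S" for w using DS(1) by blast
  have u: "u = r \<or> f (p u) < x \<and> x < f (p' u) \<and> p u \<noteq> e \<and> p' u \<noteq> e"
  proof (cases "u = r")
    case False
    then have "u \<in> S" using assms(2) DSD by auto
    then show ?thesis using False pE(3,4)[of u] yz(2) x by auto
  qed simp
  have en: "en e = {#v, u#}" using assms(4) by (simp add: add_mset_commute)
  \<comment> \<open>One argument for both parent maps, to be used with the heights and with their
    negatives.\<close>
  have br: "branch (insert e E) (insert v S) D t h' (a(v := e)) (b(v := u))"
    if br: "branch E S D t h a b" and h: "\<And>w. w \<in> S \<Longrightarrow> h' (a w) = h (a w)"
      and u: "u = r \<or> h' (a u) < h' e" for h h' a b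
  proof -
    have "(a(v := e)) w \<in> insert e E \<and> en ((a(v := e)) w) = {#w, (b(v := u)) w#} \<and>
      (w \<in> D \<longrightarrow> cix ((a(v := e)) w) \<le> t w) \<and>
      ((b(v := u)) w = r \<or> (b(v := u)) w \<in> D \<and>
        h' ((a(v := e)) ((b(v := u)) w)) < h' ((a(v := e)) w) \<and>
        t ((b(v := u)) w) \<le> cix ((a(v := e)) w))" if "w \<in> insert v S" for w
    proof (cases "w = v")
      case True
      then show ?thesis using en vD assms(2,5) u by auto
    next
      case False
      then have w: "w \<in> S" using that by simp
      then have "a w \<in> E" "en (a w) = {#w, b w#}" "w \<in> D \<longrightarrow> cix (a w) \<le> t w"
        "b w = r \<or> b w \<in> D \<and> h (a (b w)) < h (a w) \<and> t (b w) \<le> cix (a w)"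
        using br by (auto simp: branch_def)
      moreover have "b w \<noteq> v" if "b w \<in> D" using that vD(1) by blast
      ultimately show ?thesis using False h w DSD assms(3) by auto
    qed
    then show ?thesis unfolding branch_def by blast
  qed
  have "branch (insert e E) (insert v S) D t ?f (p(v := e)) (q(v := u))"
    using B pE u by (intro br[of f]) (auto simp: bipolar_def)
  moreover have "branch (insert e E) (insert v S) D t (\<lambda>a. - ?f a) (p'(v := e)) (q'(v := u))"
    using B pE u by (intro br[of "\<lambda>a. - f a"]) (auto simp: bipolar_def)
  moreover have "inj_on (\<lambda>w. ?f ((p(v := e)) w)) (insert v S - D)"
  proof -
    have inj: "inj_on (\<lambda>w. f (p w)) (S - D)" using B by (simp add: bipolar_def)
    have val: "?f ((p(v := e)) w) = (if w = v then x else f (p w))" if "w \<in> insert v S" for w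
      using that pE(3)[of w] by auto
    show ?thesis
    proof (rule inj_onI)
      fix a b
      assume ab: "a \<in> insert v S - D" "b \<in> insert v S - D"
        and "?f ((p(v := e)) a) = ?f ((p(v := e)) b)"
      then have "(if a = v then x else f (p a)) = (if b = v then x else f (p b))"
        using val[of a] val[of b] by simp
      then show "a = b" using x ab inj_onD[OF inj, of a b] by (auto split: if_splits)
    qed
  qed
  moreover have "\<forall>w\<in>D. ?f ((p(v := e)) w) < ?f ((p'(v := e)) w)"
    using B pE DSD vD(1) by (auto simp: bipolar_def)
  moreover have "\<forall>w\<in>insert v S. ?f ((p(v := e)) w) \<le> ?f ((p'(v := e)) w)"
    using B pE by (auto simp: bipolar_def)
  ultimately have "bipolar i (insert e E) (insert v S) D t ?f (p(v := e)) (q(v := u))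
      (p'(v := e)) (q'(v := u))"
    using B assms(3,5) unfolding bipolar_def by (intro conjI) auto
  then show ?thesis unfolding orientable_def by blast
qed

text \<open>This is how a chain is discarded: its edges count as met, but no parent edge
  changes.\<close>

lemma orientable_more_edges:
  assumes "orientable i E S D t" "E \<subseteq> E'" "\<And>e. e \<in> E' \<Longrightarrow> cix e \<le> i"
  shows "orientable i E' S D t"
proof -
  obtain f p q p' q' where B: "bipolar i E S D t f p q p' q'"
    using assms(1) unfolding orientable_def by blast
  have "branch E' S D t h a b" if "branch E S D t h a b" for h a b
    using that assms(2) unfolding branch_def by blast
  then have "bipolar i E' S D t f p q p' q'" using B assms(3) by (simp add: bipolar_def)
  then show ?thesis unfolding orientable_def by blast
qed

text \<open>Off \<open>D\<close>, \<open>t\<close> moves along with the current index. A vertex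
  completed later therefore already carries the index of the completing chain, and completion leaves
  \<open>t\<close> unchanged.\<close>

lemma orientable_Suc:
  assumes "orientable i E S D t"
  shows "orientable (Suc i) E S D (\<lambda>v. if v \<in> D then t v else Suc i)"
proof -
  obtain f p q p' q' where "bipolar i E S D t f p q p' q'"
    using assms unfolding orientable_def by blast
  then have "bipolar (Suc i) E S D (\<lambda>v. if v \<in> D then t v else Suc i) f p q p' q'"
    by (auto simp: bipolar_def branch_def le_Suc_eq)
  then show ?thesis unfolding orientable_def by blast
qed

end

section \<open>Chain decompositions\<close>

lemma degree_outside: "multigraph C \<Longrightarrow> v \<notin> verts C \<Longrightarrow> degree C v = 0"
  unfolding degree_def
  by (rule sum.neutral) (auto simp: not_in_iff dest!: multigraph.ends_in_verts)

lemma subgraph_union_subgraphs: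
  assumes "multigraph G" "\<And>i. i \<in> I \<Longrightarrow> subgraph (Gs i) G"
  shows "subgraph (union_subgraphs G Gs I) G"
proof -
  have sub: "(\<Union>i\<in>I. verts (Gs i)) \<subseteq> verts G" "(\<Union>i\<in>I. edges (Gs i)) \<subseteq> edges G"
    using assms(2) by (auto simp: subgraph_def)
  have "finite (\<Union>i\<in>I. verts (Gs i))" "finite (\<Union>i\<in>I. edges (Gs i))"
    using sub assms(1) finite_subset by (auto simp: multigraph_def)
  moreover have "set_mset (ends G e) \<subseteq> (\<Union>i\<in>I. verts (Gs i))" if "e \<in> (\<Union>i\<in>I. edges (Gs i))" for e
  proof -
    obtain i where i: "i \<in> I" "e \<in> edges (Gs i)" using \<open>e \<in> _\<close> by blast
    then have "multigraph (Gs i)" "ends (Gs i) = ends G" using assms(2) by (auto simp: subgraph_def)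
    then show ?thesis using multigraph.ends_in_verts[of "Gs i" e] i by auto
  qed
  moreover have "size (ends G e) = 2" if "e \<in> (\<Union>i\<in>I. edges (Gs i))" for e
    using that sub(2) assms(1) by (auto simp: multigraph_def)
  ultimately show ?thesis
    using sub unfolding subgraph_def multigraph_def union_subgraphs_def by simp
qed

lemma degree_mono:
  assumes "multigraph G" "subgraph H G"
  shows "degree H v \<le> degree G v"
  using assms unfolding degree_def subgraph_def multigraph_def by (auto intro!: sum_mono2)

lemma path_graph_walk:
  assumes "path_graph C u v" "edges C \<noteq> {}"
  obtains w c n where "0 < n" "inj_on c {..<n}" "inj_on w {0..n}" "w 0 = u" "w n = v"
    "verts C = w ` {0..n}" "edges C = c ` {..<n}"
    "\<And>k. k < n \<Longrightarrow> ends C (c k) = {#w k, w (Suc k)#}"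
proof -
  obtain vs es where vs: "length vs = Suc (length es)" "distinct vs" "hd vs = u" "last vs = v"
      "verts C = set vs" "edges C = set es"
      "\<And>i. i < length es \<Longrightarrow> ends C (es ! i) = {#vs ! i, vs ! Suc i#}"
    using assms(1) unfolding path_graph_def by metis
  let ?n = "length es"
  have eq: "vs ! j = vs ! k \<longleftrightarrow> j = k" if "j \<le> ?n" "k \<le> ?n" for j k
    using nth_eq_iff_index_eq[OF vs(2)] that vs(1) by simp
  have "vs \<noteq> []" using vs(1) by auto
  then have "vs ! 0 = u" "vs ! ?n = v" using vs by (auto simp: hd_conv_nth last_conv_nth)
  moreover have "0 < ?n" using assms(2) vs(6) by auto
  \<comment> \<open>Distinctness of the edges is not part of \<open>path_graph\<close>; it follows
    from that of the vertices, as equal edges have equal ends.\<close>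
  moreover have "inj_on ((!) es) {..<?n}"
  proof (rule inj_onI)
    fix j k assume jk: "j \<in> {..<?n}" "k \<in> {..<?n}" "es ! j = es ! k"
    then have "{#vs ! j, vs ! Suc j#} = {#vs ! k, vs ! Suc k#}" using vs(7) by (metis lessThan_iff)
    then have "vs ! j = vs ! k \<or> vs ! j = vs ! Suc k \<and> vs ! Suc j = vs ! k"
      by (auto simp: add_eq_conv_ex)
    then show "j = k" using jk eq by auto
  qed
  moreover have "inj_on ((!) vs) {0..?n}" using eq by (auto simp: inj_on_def)
  moreover have "set vs = (!) vs ` {0..?n}"
    using vs(1) by (auto simp: set_conv_nth less_Suc_eq_le)
  moreover have "set es = (!) es ` {..<?n}"
    by (auto simp: set_conv_nth)
  ultimately show thesis using that[of ?n "(!) es" "(!) vs"] vs by simp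
qed

text \<open>The cycle is rotated to start and end at the prescribed vertex, which is to be its
  attachment to the older part.\<close>

lemma cycle_graph_walk:
  assumes "cycle_graph C" "v \<in> verts C"
  obtains w c n where "0 < n" "inj_on c {..<n}" "inj_on w {..<n}" "inj_on w {0<..n}"
    "w 0 = v" "w n = v" "verts C = w ` {0..n}" "edges C = c ` {..<n}"
    "\<And>k. k < n \<Longrightarrow> ends C (c k) = {#w k, w (Suc k)#}"
proof -
  obtain vs es where vs: "vs \<noteq> []" "length vs = length es"
      "distinct vs" "distinct es" "verts C = set vs" "edges C = set es"
      "\<And>i. i < length es \<Longrightarrow> ends C (es ! i) = {#vs ! i, vs ! (Suc i mod length vs)#}"
    using assms(1) unfolding cycle_graph_def by metis
  let ?n = "length es"
  have n: "0 < ?n" using vs(1,2) by auto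
  obtain a where a: "a < ?n" "vs ! a = v" using assms(2) vs(2,5) by (metis in_set_conv_nth)
  define s where "s k = (a + k) mod ?n" for k
  have s_less: "s k < ?n" for k using n by (simp add: s_def)
  have s_ne: "s j \<noteq> s k" if "j < k" "k - j < ?n" for j k
  proof
    assume "s j = s k"
    then have "?n dvd (a + k) - (a + j)"
      using mod_eq_dvd_iff_nat[of "a + j" "a + k" ?n] that(1) by (simp add: s_def)
    then show False using that by (auto dest: dvd_imp_le)
  qed
  have s_inj: "inj_on s {..<?n}" "inj_on s {0<..?n}"
    by (rule linorder_inj_onI; use s_ne in force)+
  have s_image: "s ` {..<?n} = {..<?n}"
    by (rule endo_inj_surj) (use s_less s_inj in auto)
  have "s ` {0..?n} = {..<?n}"
  proof
    show "s ` {0..?n} \<subseteq> {..<?n}" using s_less by auto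
    have "s ` {..<?n} \<subseteq> s ` {0..?n}" by (intro image_mono) auto
    then show "{..<?n} \<subseteq> s ` {0..?n}" using s_image by simp
  qed
  moreover have "set vs = (!) vs ` {..<?n}" "set es = (!) es ` {..<?n}"
    using vs(2) by (auto simp: set_conv_nth)
  ultimately have "set vs = (\<lambda>k. vs ! s k) ` {0..?n}" "set es = (\<lambda>k. es ! s k) ` {..<?n}"
    using s_image by (metis image_image)+
  moreover have "inj_on (\<lambda>k. vs ! s k) A" "inj_on (\<lambda>k. es ! s k) A" if "inj_on s A" for A
    using that s_less vs(2-4) by (auto simp: inj_on_def nth_eq_iff_index_eq)
  moreover have "s 0 = a" "s ?n = a" using a by (simp_all add: s_def)
  moreover have "ends C (es ! s k) = {#vs ! s k, vs ! s (Suc k)#}" for k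
    using vs(7)[OF s_less[of k]] vs(2) by (simp add: s_def mod_Suc_eq)
  ultimately show thesis
    using that[of ?n "\<lambda>k. es ! s k" "\<lambda>k. vs ! s k"] vs(5,6) a n s_inj by simp
qed

section \<open>Induction along the chains\<close>

locale chain_decomposed =
  fixes G :: "('v, 'e) mgraph" and r :: 'v and m :: nat and Gs :: "nat \<Rightarrow> ('v, 'e) mgraph"
    and cix :: "'e \<Rightarrow> nat"
  assumes graph: "multigraph G" and no_isolated: "\<nexists>v. isolated G v" and root: "r \<in> verts G"
    and dec: "chain_decomposition G r m Gs"
    and cix: "i \<le> m \<Longrightarrow> e \<in> edges (Gs i) \<Longrightarrow> cix e = i"
begin

sublocale rooted_incidence "ends G" r cix .

definition before :: "nat \<Rightarrow> ('v, 'e) mgraph" where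
  "before i = union_subgraphs G Gs {..<i}"

definition after :: "nat \<Rightarrow> ('v, 'e) mgraph" where
  "after i = union_subgraphs G Gs {i<..m}"

text \<open>The state just before chain \<open>i\<close>. Two edges at \<open>v\<close> after chain
  \<open>t v\<close> are what the reversed decomposition meets as earlier edges; the last clause,
  read there, then bounds its completion index, and for this it must hold at every earlier
  \<open>j\<close>. The bound on \<open>degree G\<close> forces every reached vertex to be completed
  in the end.\<close>

definition stage :: "nat \<Rightarrow> 'v set \<Rightarrow> 'v set \<Rightarrow> ('v \<Rightarrow> nat) \<Rightarrow> bool" where
  "stage i S D t \<longleftrightarrow>
     orientable i (edges (before i)) S D t \<and> S \<subseteq> verts G \<and> verts (before i) \<subseteq> insert r S \<and>
     (\<forall>v\<in>D. t v < i \<and> 2 \<le> degree (after (t v)) v) \<and> (\<forall>v\<in>S. 2 \<le> degree G v) \<and>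
     (\<forall>j\<le>i. \<forall>v. v \<noteq> r \<longrightarrow> 2 \<le> degree (before j) v \<longrightarrow> v \<in> D \<and> t v < j)"

lemma chain_subgraph: "i \<le> m \<Longrightarrow> subgraph (Gs i) G"
  using dec by (simp add: chain_decomposition_def)

lemma before_subgraph: "i \<le> Suc m \<Longrightarrow> subgraph (before i) G"
  unfolding before_def using chain_subgraph by (intro subgraph_union_subgraphs[OF graph]) auto

lemma after_subgraph: "subgraph (after i) G"
  unfolding after_def using chain_subgraph by (intro subgraph_union_subgraphs[OF graph]) auto

lemma before_Suc:
  "verts (before (Suc i)) = verts (before i) \<union> verts (Gs i)"
  "edges (before (Suc i)) = edges (before i) \<union> edges (Gs i)"
  by (auto simp: before_def union_subgraphs_def less_Suc_eq)

lemma cix_before: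
  assumes "e \<in> edges (before i)" "i \<le> Suc m"
  shows "cix e < i"
proof -
  obtain j where "j < i" "e \<in> edges (Gs j)"
    using assms(1) by (auto simp: before_def union_subgraphs_def)
  then show ?thesis using cix[of j e] assms(2) by simp
qed

lemma degree_before_Suc:
  assumes "i \<le> m"
  shows "degree (before (Suc i)) v = degree (before i) v + degree (Gs i) v"
proof -
  have sub: "subgraph (before i) G" "subgraph (Gs i) G" "ends (before (Suc i)) = ends G"
    using before_subgraph[of i] chain_subgraph[OF assms] assms
    by (auto simp: before_def union_subgraphs_def)
  then have "finite (edges (before i))" "finite (edges (Gs i))"
    by (auto simp: subgraph_def multigraph_def)
  moreover have "edges (before i) \<inter> edges (Gs i) = {}"
    using cix_before[of _ i] cix assms by fastforce
  ultimately show ?thesis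
    using sub unfolding degree_def before_Suc by (simp add: sum.union_disjoint subgraph_def)
qed

lemma degree_before_Suc_outside:
  "i \<le> m \<Longrightarrow> v \<notin> verts (Gs i) \<Longrightarrow> degree (before (Suc i)) v = degree (before i) v"
  using degree_outside[of "Gs i" v] chain_subgraph[of i] by (simp add: degree_before_Suc subgraph_def)

text \<open>The bookkeeping shared by all kinds of chain. Since \<open>t\<close> equals
  \<open>i\<close> off \<open>D\<close>, two edges after chain \<open>i\<close> at each newly
  completed vertex are exactly what the invariant demands.\<close>

lemma stage_Suc:
  assumes st: "stage i S D t" and i: "i \<le> m"
    and ori: "orientable i (edges (before (Suc i))) S' D' t"
    and S': "S \<subseteq> S'" "S' - S \<subseteq> verts (Gs i)" "verts (Gs i) \<subseteq> insert r S'" and D': "D \<subseteq> D'"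
    and deg: "\<And>v. v \<in> (S' - S) \<union> (D' - D) \<Longrightarrow> 2 \<le> degree (after i) v"
    and complete: "\<And>v. v \<noteq> r \<Longrightarrow> 2 \<le> degree (before (Suc i)) v \<Longrightarrow> v \<in> D'"
  shows "stage (Suc i) S' D' (\<lambda>v. if v \<in> D' then t v else Suc i)"
proof -
  have t: "t v \<le> i" "v \<notin> D \<Longrightarrow> t v = i" for v
    using st by (auto simp: stage_def orientable_def bipolar_def)
  have "S' \<subseteq> verts G"
    using st S'(2) chain_subgraph[OF i] by (auto simp: stage_def subgraph_def)
  moreover have "verts (before (Suc i)) \<subseteq> insert r S'"
    using st S'(1,3) unfolding before_Suc stage_def by blast
  moreover have "t v < Suc i \<and> 2 \<le> degree (after (t v)) v" if "v \<in> D'" for v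
  proof (cases "v \<in> D")
    case False
    then show ?thesis using t deg that by auto
  qed (use st in \<open>auto simp: stage_def\<close>)
  moreover have "2 \<le> degree G v" if "v \<in> S'" for v
  proof (cases "v \<in> S")
    case False
    then have "2 \<le> degree (after i) v" using deg that by blast
    then show ?thesis using degree_mono[OF graph after_subgraph] order_trans by blast
  qed (use st in \<open>auto simp: stage_def\<close>)
  moreover have "v \<in> D' \<and> t v < j" if "j \<le> Suc i" "v \<noteq> r" "2 \<le> degree (before j) v" for j v
  proof (cases "j = Suc i")
    case True
    then show ?thesis using complete that t(1)[of v] by auto
  next
    case False
    then have "j \<le> i" using that by simp
    then have "v \<in> D \<and> t v < j" using st that by (simp add: stage_def)
    then show ?thesis using D' by blast
  qed
  ultimately show ?thesis
    unfolding stage_def using orientable_Suc[OF ori] by auto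
qed

text \<open>Serves down chains and one-way edges whose head is the root or completed: nothing new is
  reached or completed.\<close>

lemma stage_skip:
  assumes st: "stage i S D t" and i: "i \<le> m" and C: "verts (Gs i) \<subseteq> insert r D"
  shows "\<exists>S D t. stage (Suc i) S D t"
proof -
  have ori: "orientable i (edges (before i)) S D t" and DS: "D \<subseteq> S"
    using st by (auto simp: stage_def orientable_def bipolar_def)
  have "orientable i (edges (before (Suc i))) S D t"
    using cix_before[of _ "Suc i"] i
    by (intro orientable_more_edges[OF ori]) (auto simp: before_Suc(2) less_Suc_eq_le)
  moreover have "v \<in> D" if "v \<noteq> r" "2 \<le> degree (before (Suc i)) v" for v
  proof (cases "v \<in> verts (Gs i)")
    case False
    then show ?thesis using degree_before_Suc_outside[OF i] st that by (auto simp: stage_def)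
  qed (use C that in auto)
  ultimately show ?thesis using stage_Suc[OF st i, of S D] C DS by blast
qed

text \<open>Serves up chains and one-way edges with a pending head: every vertex of the chain other
  than the root ends up completed.\<close>

lemma stage_walk:
  assumes st: "stage i S D t" and i: "i \<le> m"
    and w: "0 < n" "inj_on c {..<n}" "inj_on w {..<n}" "inj_on w {0<..n}"
      "\<And>k. k < n \<Longrightarrow> ends G (c k) = {#w k, w (Suc k)#}"
      "w 0 \<in> insert r S" "w n \<in> insert r S" "w 0 = w n \<Longrightarrow> w 0 \<in> insert r D"
    and C: "verts (Gs i) = w ` {0..n}" "edges (Gs i) = c ` {..<n}"
    and deg: "\<And>v. v \<in> verts (Gs i) \<Longrightarrow> v \<noteq> r \<Longrightarrow> v \<notin> D \<Longrightarrow> 2 \<le> degree (after i) v"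
  shows "\<exists>S D t. stage (Suc i) S D t"
proof -
  let ?V = "verts (Gs i) - {r}"
  have ori: "orientable i (edges (before i)) S D t" and DS: "D \<subseteq> S"
    using st by (auto simp: stage_def orientable_def bipolar_def)
  have "cix (c k) = i \<and> c k \<notin> edges (before i)" if "k < n" for k
  proof -
    have "cix (c k) = i" using cix[OF i, of "c k"] C(2) that by simp
    then show ?thesis using cix_before[of "c k" i] i by auto
  qed
  then have "orientable i (edges (before (Suc i))) (S \<union> ?V) (D \<union> ?V) t"
    unfolding before_Suc C by (intro orientable_walk[OF ori w]) auto
  moreover have "v \<in> D \<union> ?V" if "v \<noteq> r" "2 \<le> degree (before (Suc i)) v" for v
  proof (cases "v \<in> verts (Gs i)")
    case False
    then show ?thesis using degree_before_Suc_outside[OF i] st that by (auto simp: stage_def)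
  qed (use that in auto)
  moreover have "2 \<le> degree (after i) v" if "v \<in> (S \<union> ?V - S) \<union> (D \<union> ?V - D)" for v
    using deg that DS by blast
  ultimately show ?thesis using stage_Suc[OF st i, of "S \<union> ?V" "D \<union> ?V"] by blast
qed

text \<open>The head decides: if it is the root or completed, the edge is discarded (this includes
  loops); if pending, the edge is an ear of length one; if new, the edge is pendant.\<close>

lemma stage_one_way:
  assumes st: "stage i S D t" and i: "i \<le> m"
    and C: "Gs i = \<lparr>verts = {u, v}, edges = {e}, ends = ends G\<rparr>" and e: "ends G e = {#u, v#}"
    and u: "u \<in> insert r D" and v: "v = r \<or> 2 \<le> degree (after i) v"
  shows "\<exists>S D t. stage (Suc i) S D t"
proof -
  have ori: "orientable i (edges (before i)) S D t" and DS: "D \<subseteq> S"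
    using st by (auto simp: stage_def orientable_def bipolar_def)
  consider "v \<in> insert r D" | "v \<in> S" "v \<notin> insert r D" | "v \<notin> insert r S" by auto
  then show ?thesis
  proof cases
    case 1
    then show ?thesis using stage_skip[OF st i] C u by simp
  next
    case 2
    let ?w = "\<lambda>k::nat. if k = 0 then u else v"
    have "?w ` {0..1} = {u, v}" by auto
    moreover have "u \<noteq> v" using u 2 by blast
    ultimately show ?thesis
      by (intro stage_walk[OF st i, of 1 "\<lambda>k. e" ?w])
        (use C e u v 2 DS in \<open>auto simp: inj_on_def\<close>)
  next
    case 3
    have "cix e = i" using cix[OF i, of e] C by simp
    moreover from this have "e \<notin> edges (before i)" using cix_before[of e i] i by auto
    ultimately have "orientable i (edges (before (Suc i))) (insert v S) D t"
      using orientable_pendant[OF ori u 3 e] C by (simp add: before_Suc)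
    moreover have "x \<in> D" if x: "x \<noteq> r" "2 \<le> degree (before (Suc i)) x" for x
    proof (cases "x = v")
      case True
      \<comment> \<open>The new head has degree one so far, so the invariant does not yet ask for
        its completion.\<close>
      have "v \<notin> verts (before i)" using st 3 by (auto simp: stage_def)
      then have "degree (before i) v = 0"
        using degree_outside before_subgraph[of i] i by (auto simp: subgraph_def)
      moreover have "u \<noteq> v" using u 3 DS by blast
      then have "degree (Gs i) v = 1" using e C by (simp add: degree_def)
      ultimately show ?thesis using x True degree_before_Suc[OF i, of v] by simp
    next
      case False
      show ?thesis
      proof (cases "x = u")
        case True
        then show ?thesis using u x by simp
      next
        case neq: False
        then have "degree (before (Suc i)) x = degree (before i) x"
          using degree_before_Suc_outside[OF i] False C by simp
        then show ?thesis using st x by (auto simp: stage_def)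
      qed
    qed
    moreover have "insert v S - S \<subseteq> verts (Gs i)" "verts (Gs i) \<subseteq> insert r (insert v S)"
      using C u DS by auto
    moreover have "2 \<le> degree (after i) x" if "x \<in> (insert v S - S) \<union> (D - D)" for x
      using that v 3 by auto
    ultimately show ?thesis
      using stage_Suc[OF st i, of "insert v S" D] by blast
  qed
qed

lemma stage_step:
  assumes st: "stage i S D t" and i: "i \<le> m"
  shows "\<exists>S D t. stage (Suc i) S D t"
proof -
  have DS: "D \<subseteq> S" and ver: "verts (before i) \<subseteq> insert r S"
    using st by (auto simp: stage_def orientable_def bipolar_def)
  \<comment> \<open>Translates the degree conditions on the earlier chains: cycles of up chains may
    close at such a vertex, one-way tails are such vertices, and down chains consist of them
    entirely.\<close>
  have D: "v \<in> insert r D" if "v = r \<or> 2 \<le> degree (before i) v" for v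
    using st that by (auto simp: stage_def)
  have ends: "ends (Gs i) = ends G" using chain_subgraph[OF i] by (simp add: subgraph_def)
  have "up_chain G r (before i) (after i) (Gs i) \<or> down_chain G r (before i) (after i) (Gs i) \<or>
      one_way_chain G r (before i) (after i) (Gs i)"
    using dec i unfolding chain_decomposition_def before_def after_def by (auto simp: Let_def)
  then consider
      u v where "path_graph (Gs i) u v" "edges (Gs i) \<noteq> {}"
        "\<forall>w\<in>verts (Gs i). w = r \<or> 2 \<le> degree (after i) w"
        "u = r \<or> u \<in> verts (before i)" "v = r \<or> v \<in> verts (before i)"
    | v where "cycle_graph (Gs i)" "\<forall>w\<in>verts (Gs i). w = r \<or> 2 \<le> degree (after i) w"
        "v \<in> verts (Gs i)" "v = r \<or> 2 \<le> degree (before i) v"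
    | "down_chain G r (before i) (after i) (Gs i)"
    | "one_way_chain G r (before i) (after i) (Gs i)"
    unfolding up_chain_def by blast
  then show ?thesis
  proof cases
    case 1
    from 1(1,2) obtain w c n where w: "0 < n" "inj_on c {..<n}" "inj_on w {0..n}" "w 0 = u"
      "w n = v" "verts (Gs i) = w ` {0..n}" "edges (Gs i) = c ` {..<n}"
      "\<And>k. k < n \<Longrightarrow> ends (Gs i) (c k) = {#w k, w (Suc k)#}"
      by (rule path_graph_walk) blast
    have "inj_on w {..<n}" "inj_on w {0<..n}" by (rule inj_on_subset[OF w(3)]; auto)+
    moreover have "w 0 \<noteq> w n" using inj_onD[OF w(3), of 0 n] w(1) by auto
    moreover have "w 0 \<in> insert r S" "w n \<in> insert r S" using 1(4,5) w(4,5) ver by auto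
    ultimately show ?thesis
      using 1(3) w(8) ends by (intro stage_walk[OF st i w(1,2) _ _ _ _ _ _ w(6,7)]) auto
  next
    case 2
    from 2(1,3) obtain w c n where w: "0 < n" "inj_on c {..<n}" "inj_on w {..<n}"
      "inj_on w {0<..n}" "w 0 = v" "w n = v" "verts (Gs i) = w ` {0..n}" "edges (Gs i) = c ` {..<n}"
      "\<And>k. k < n \<Longrightarrow> ends (Gs i) (c k) = {#w k, w (Suc k)#}"
      by (rule cycle_graph_walk) blast
    have "v \<in> insert r D" using D 2(4) by blast
    then show ?thesis
      using 2(2) w(5,6,9) ends DS by (intro stage_walk[OF st i w(1-4) _ _ _ _ w(7,8)]) auto
  next
    case 3
    then have "verts (Gs i) \<subseteq> insert r D"
      using D unfolding down_chain_def up_chain_def by blast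
    then show ?thesis by (rule stage_skip[OF st i])
  next
    case 4
    then show ?thesis unfolding one_way_chain_def using stage_one_way[OF st i] D by metis
  qed
qed

lemma stage_exists: "i \<le> Suc m \<Longrightarrow> \<exists>S D t. stage i S D t"
proof (induction i)
  case 0
  have "orientable 0 {} {} {} (\<lambda>_. 0)"
    by (simp add: orientable_def bipolar_def branch_def)
  then have "stage 0 {} {} (\<lambda>_. 0)"
    by (simp add: stage_def before_def union_subgraphs_def degree_def)
  then show ?case by blast
next
  case (Suc i)
  then show ?case using stage_step by auto
qed

text \<open>After the last chain nothing is pending: without isolated vertices every vertex has been
  met, and each one other than \<open>r\<close> has degree at least two in \<open>G\<close>, all of
  whose edges have been seen.\<close>

lemma bipolar_exists:
  obtains t f p q p' q' where
    "bipolar (Suc m) (edges G) (verts G - {r}) (verts G - {r}) t f p q p' q'"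
    "\<And>v. v \<in> verts G - {r} \<Longrightarrow> t v \<le> m \<and> 2 \<le> degree (after (t v)) v"
    "\<And>j v. j \<le> m \<Longrightarrow> v \<in> verts G - {r} \<Longrightarrow> 2 \<le> degree (before j) v \<Longrightarrow> t v < j"
proof -
  obtain S D t where st: "stage (Suc m) S D t" using stage_exists by blast
  have DS: "D \<subseteq> S" "S \<subseteq> verts G - {r}"
    using st by (auto simp: stage_def orientable_def bipolar_def)
  have E: "edges (before (Suc m)) = edges G"
    using dec by (simp add: before_def union_subgraphs_def chain_decomposition_def lessThan_Suc_atMost)
  have deg: "degree (before (Suc m)) v = degree G v" for v
    using E by (simp add: degree_def) (simp add: before_def union_subgraphs_def)
  have "v \<in> D" if v: "v \<in> verts G - {r}" for v
  proof -
    have "degree (before (Suc m)) v \<noteq> 0" using v no_isolated deg by (auto simp: isolated_def)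
    then have "v \<in> verts (before (Suc m))"
      using degree_outside[of "before (Suc m)" v] before_subgraph[of "Suc m"]
      by (auto simp: subgraph_def)
    then have "v \<in> S" using st v by (auto simp: stage_def)
    then have "2 \<le> degree (before (Suc m)) v" using st deg by (simp add: stage_def)
    then show ?thesis using st v unfolding stage_def by blast
  qed
  then have eq: "D = verts G - {r}" "S = verts G - {r}" using DS by auto
  then obtain f p q p' q' where
    "bipolar (Suc m) (edges G) (verts G - {r}) (verts G - {r}) t f p q p' q'"
    using st E unfolding stage_def orientable_def by auto
  then show thesis using that st eq by (auto simp: stage_def less_Suc_eq_le)
qed

text \<open>The height of a vertex is that of its parent edge, negated for the upper map so that it
  too descends.\<close>

lemma parent_maps:
  assumes "bipolar (Suc m) (edges G) (verts G - {r}) (verts G - {r}) t f p q p' q'"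
  shows "parent_map G r p q (\<lambda>v. f (p v))" "parent_map G r p' q' (\<lambda>v. - f (p' v))"
  using assms graph root by (auto simp: parent_map_def bipolar_def branch_def)

end

section \<open>Reversal of the decomposition and independence of the four trees\<close>

lemma edge_independent_sym: "edge_independent r T T' \<Longrightarrow> edge_independent r T' T"
  unfolding edge_independent_def edge_disjoint_def by blast

text \<open>A common edge of the two paths to \<open>v\<close> would be bounded in both weights by
  the respective parent edges of \<open>v\<close>. Within a pair of trees the weights are opposite
  heights, across the pairs opposite chain indices.\<close>

lemma edge_independent_parent_maps:
  fixes \<kappa> :: "'e \<Rightarrow> 'a::preorder" and \<kappa>' :: "'e \<Rightarrow> 'b::preorder"
  assumes "parent_map G r p q h" "parent_map G r p' q' h'"
    and "\<And>x. x \<in> verts G - {r} \<Longrightarrow> q x \<noteq> r \<Longrightarrow> \<kappa> (p (q x)) \<le> \<kappa> (p x)"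
    and "\<And>x. x \<in> verts G - {r} \<Longrightarrow> q' x \<noteq> r \<Longrightarrow> \<kappa>' (p' (q' x)) \<le> \<kappa>' (p' x)"
    and disjoint: "\<And>v e. v \<in> verts G - {r} \<Longrightarrow> e \<in> edges G \<Longrightarrow> \<kappa> e \<le> \<kappa> (p v) \<Longrightarrow>
      \<kappa>' e \<le> \<kappa>' (p' v) \<Longrightarrow> False"
  shows "edge_independent r (parent_map.parent_tree G r p) (parent_map.parent_tree G r p')"
proof -
  interpret A: parent_map G r p q h by fact
  interpret B: parent_map G r p' q' h' by fact
  have "edge_disjoint P P'" if v: "v \<in> verts G" and P: "subgraph P A.parent_tree" "path_graph P r v"
    and P': "subgraph P' B.parent_tree" "path_graph P' r v" for v P P'
  proof -
    have False if e: "e \<in> edges P" "e \<in> edges P'" for e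
    proof -
      have "v \<noteq> r" "\<kappa> e \<le> \<kappa> (p v)" using A.path_edge_le[OF P e(1)] assms(3) by blast+
      moreover have "\<kappa>' e \<le> \<kappa>' (p' v)" using B.path_edge_le(2)[OF P' e(2)] assms(4) by blast
      moreover have "e \<in> edges G"
        using e(1) P(1) A.subgraph_parent_tree by (auto simp: subgraph_def)
      ultimately show False using disjoint[of v e] v by blast
    qed
    then show ?thesis unfolding edge_disjoint_def by blast
  qed
  then show ?thesis unfolding edge_independent_def using A.root by (simp add: A.parent_tree_def B.parent_tree_def)
qed

lemma union_subgraphs_reverse:
  assumes "i \<le> m"
  shows "union_subgraphs G (\<lambda>k. Gs (m - k)) {..<i} = union_subgraphs G Gs {m - i<..m}"
    and "union_subgraphs G (\<lambda>k. Gs (m - k)) {i<..m} = union_subgraphs G Gs {..<m - i}"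
proof -
  have "bij_betw (\<lambda>k. m - k) {..<i} {m - i<..m}"
    by (rule bij_betwI[of _ _ _ "\<lambda>k. m - k"]) (use assms in auto)
  then have 1: "(\<lambda>k. m - k) ` {..<i} = {m - i<..m}" by (simp add: bij_betw_def)
  have "bij_betw (\<lambda>k. m - k) {i<..m} {..<m - i}"
    by (rule bij_betwI[of _ _ _ "\<lambda>k. m - k"]) auto
  then have 2: "(\<lambda>k. m - k) ` {i<..m} = {..<m - i}" by (simp add: bij_betw_def)
  show "union_subgraphs G (\<lambda>k. Gs (m - k)) {..<i} = union_subgraphs G Gs {m - i<..m}"
    and "union_subgraphs G (\<lambda>k. Gs (m - k)) {i<..m} = union_subgraphs G Gs {..<m - i}"
    unfolding union_subgraphs_def 1[symmetric] 2[symmetric] by simp_all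
qed

lemma one_way_chain_swap:
  assumes "one_way_chain G r H K C"
  shows "one_way_chain G r K H C"
proof -
  obtain e u v where "e \<in> edges G" "e \<notin> edges H \<union> edges K" "ends G e = {#u, v#}"
    "C = \<lparr>verts = {u, v}, edges = {e}, ends = ends G\<rparr>"
    "u = r \<or> degree H u \<ge> 2" "v = r \<or> degree K v \<ge> 2"
    using assms unfolding one_way_chain_def by blast
  then show ?thesis
    unfolding one_way_chain_def
    by (intro exI[of _ e] exI[of _ v] exI[of _ u]) (simp add: insert_commute add_mset_commute)
qed

text \<open>Earlier and later chains change places, so up and down chains are interchanged and a
  one-way edge swaps tail and head.\<close>

lemma chain_decomposition_reverse:
  assumes "chain_decomposition G r m Gs"
  shows "chain_decomposition G r m (\<lambda>i. Gs (m - i))"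
proof -
  have "bij_betw (\<lambda>i. m - i) {..m} {..m}"
    by (rule bij_betwI[of _ _ _ "\<lambda>i. m - i"]) auto
  then have "(\<lambda>i. m - i) ` {..m} = {..m}" by (simp add: bij_betw_def)
  then have "(\<Union>i\<le>m. edges (Gs (m - i))) = (\<Union>i\<le>m. edges (Gs i))"
    by (metis image_image)
  moreover have "disjoint_family_on (\<lambda>i. edges (Gs (m - i))) {..m}"
    using assms by (auto simp: chain_decomposition_def disjoint_family_on_def)
  moreover have "up_chain G r H K (Gs (m - i)) \<or> down_chain G r H K (Gs (m - i)) \<or>
      one_way_chain G r H K (Gs (m - i))"
    if "i \<le> m" and "H = union_subgraphs G (\<lambda>i. Gs (m - i)) {..<i}"
      and "K = union_subgraphs G (\<lambda>i. Gs (m - i)) {i<..m}" for i H K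
  proof -
    have "H = union_subgraphs G Gs {m - i<..m}" "K = union_subgraphs G Gs {..<m - i}"
      using that union_subgraphs_reverse[of i m G Gs] by simp_all
    then have "up_chain G r K H (Gs (m - i)) \<or> down_chain G r K H (Gs (m - i)) \<or>
        one_way_chain G r K H (Gs (m - i))"
      using assms by (auto simp: chain_decomposition_def Let_def)
    then show ?thesis unfolding down_chain_def using one_way_chain_swap[of G r K H "Gs (m - i)"] by blast
  qed
  ultimately show ?thesis
    using assms unfolding chain_decomposition_def Let_def by simp
qed

theorem theorem4:
  fixes G :: "('v, 'e) mgraph" and r :: 'v
  assumes "multigraph G"
    and "\<nexists>v. isolated G v"
    and "r \<in> verts G"
    and "\<exists>m Gs. chain_decomposition G r m Gs"
  shows "\<exists>T :: nat \<Rightarrow> ('v, 'e) mgraph.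
           (\<forall>i<4. spanning_tree (T i) G) \<and>
           (\<forall>i<4. \<forall>j<4. i \<noteq> j \<longrightarrow> edge_independent r (T i) (T j))"
proof -
  obtain m Gs where dec: "chain_decomposition G r m Gs" using assms(4) by blast
  define cix where "cix e = (THE i. i \<le> m \<and> e \<in> edges (Gs i))" for e
  have cix: "cix e = i" if "i \<le> m" "e \<in> edges (Gs i)" for i e
    unfolding cix_def
  proof (rule the_equality)
    fix j assume j: "j \<le> m \<and> e \<in> edges (Gs j)"
    have "disjoint_family_on (\<lambda>i. edges (Gs i)) {..m}"
      using dec by (simp add: chain_decomposition_def)
    then show "j = i" using that j unfolding disjoint_family_on_def by blast
  qed (use that in simp)
  interpret fw: chain_decomposed G r m Gs cix
    by (rule chain_decomposed.intro[OF assms(1-3) dec cix])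
  \<comment> \<open>Keeping \<open>cix\<close> a parameter of the locale lets the reversed instance
    express its indices through the forward ones.\<close>
  interpret bw: chain_decomposed G r m "\<lambda>i. Gs (m - i)" "\<lambda>e. m - cix e"
  proof (rule chain_decomposed.intro)
    show "chain_decomposition G r m (\<lambda>i. Gs (m - i))"
      using dec by (rule chain_decomposition_reverse)
    show "m - cix e = i" if "i \<le> m" "e \<in> edges (Gs (m - i))" for i e
      using cix[of "m - i" e] that by simp
  qed (use assms in auto)
  have cix_le: "cix e \<le> m" if "e \<in> edges G" for e
  proof -
    have "e \<in> (\<Union>i\<le>m. edges (Gs i))" using that dec by (simp add: chain_decomposition_def)
    then show ?thesis using cix by auto
  qed
  obtain t f p q p' q'
    where F: "fw.bipolar (Suc m) (edges G) (verts G - {r}) (verts G - {r}) t f p q p' q'"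
      "\<And>v. v \<in> verts G - {r} \<Longrightarrow> t v \<le> m \<and> 2 \<le> degree (fw.after (t v)) v"
      "\<And>j v. j \<le> m \<Longrightarrow> v \<in> verts G - {r} \<Longrightarrow> 2 \<le> degree (fw.before j) v \<Longrightarrow> t v < j"
    by (rule fw.bipolar_exists) (rule that)
  obtain s g a b a' b'
    where B: "bw.bipolar (Suc m) (edges G) (verts G - {r}) (verts G - {r}) s g a b a' b'"
      "\<And>v. v \<in> verts G - {r} \<Longrightarrow> s v \<le> m \<and> 2 \<le> degree (bw.after (s v)) v"
      "\<And>j v. j \<le> m \<Longrightarrow> v \<in> verts G - {r} \<Longrightarrow> 2 \<le> degree (bw.before j) v \<Longrightarrow> s v < j"
    by (rule bw.bipolar_exists) (rule that)
  note pm = fw.parent_maps[OF F(1)] bw.parent_maps[OF B(1)]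
  \<comment> \<open>The link between the two constructions: the chains after \<open>t v\<close> are
    the first \<open>m - t v\<close> chains of the reversed order, and with two edges at
    \<open>v\<close> among them the reversed construction has completed \<open>v\<close> by
    then.\<close>
  have s: "s v < m - t v" if "v \<in> verts G - {r}" for v
  proof -
    have "bw.before (m - t v) = fw.after (t v)"
      unfolding bw.before_def fw.after_def
      using union_subgraphs_reverse(1)[of "m - t v" m G Gs] F(2)[OF that] by simp
    then show ?thesis using B(3)[of "m - t v" v] F(2)[OF that] that by simp
  qed
  have F': "p v \<in> edges G \<and> p' v \<in> edges G \<and> cix (p v) \<le> t v \<and> cix (p' v) \<le> t v \<and>
      f (p v) < f (p' v)" if "v \<in> verts G - {r}" for v
    using F(1) that by (auto simp: fw.bipolar_def fw.branch_def)
  have F'': "(q v \<noteq> r \<longrightarrow> q v \<in> verts G - {r} \<and> f (p (q v)) < f (p v) \<and> t (q v) \<le> cix (p v)) \<and>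
      (q' v \<noteq> r \<longrightarrow> q' v \<in> verts G - {r} \<and> f (p' v) < f (p' (q' v)) \<and> t (q' v) \<le> cix (p' v))"
    if "v \<in> verts G - {r}" for v
    using F(1) that by (auto simp: fw.bipolar_def fw.branch_def)
  have B': "a v \<in> edges G \<and> a' v \<in> edges G \<and> m - cix (a v) \<le> s v \<and> m - cix (a' v) \<le> s v \<and>
      g (a v) < g (a' v)" if "v \<in> verts G - {r}" for v
    using B(1) that by (auto simp: bw.bipolar_def bw.branch_def)
  have B'': "(b v \<noteq> r \<longrightarrow> b v \<in> verts G - {r} \<and> g (a (b v)) < g (a v) \<and> s (b v) \<le> m - cix (a v)) \<and>
      (b' v \<noteq> r \<longrightarrow> b' v \<in> verts G - {r} \<and> g (a' v) < g (a' (b' v)) \<and> s (b' v) \<le> m - cix (a' v))"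
    if "v \<in> verts G - {r}" for v
    using B(1) that by (auto simp: bw.bipolar_def bw.branch_def)
  \<comment> \<open>The index \<open>t (q v)\<close> lies between the two: parent edges of
    \<open>q v\<close> come no later, and the edge from \<open>v\<close> to \<open>q v\<close> no
    earlier. The next three facts hold for the same reason.\<close>
  have up: "cix (p (q v)) \<le> cix (p v)" if "v \<in> verts G - {r}" "q v \<noteq> r" for v
    using F''[of v] F'[of "q v"] that by auto
  have up': "cix (p' (q' v)) \<le> cix (p' v)" if "v \<in> verts G - {r}" "q' v \<noteq> r" for v
    using F''[of v] F'[of "q' v"] that by auto
  have down: "m - cix (a (b v)) \<le> m - cix (a v)" if "v \<in> verts G - {r}" "b v \<noteq> r" for v
    using B''[of v] B'[of "b v"] that by auto
  have down': "m - cix (a' (b' v)) \<le> m - cix (a' v)" if "v \<in> verts G - {r}" "b' v \<noteq> r" for v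
    using B''[of v] B'[of "b' v"] that by auto
  let ?T = "parent_map.parent_tree G r"
  \<comment> \<open>The lower path stays at or below the lower edge of \<open>v\<close>, the upper
    path at or above its strictly higher upper edge.\<close>
  have 1: "edge_independent r (?T p) (?T p')"
  proof (rule edge_independent_parent_maps[OF pm(1,2), where \<kappa> = f and \<kappa>' = "\<lambda>e. - f e"])
    fix v e assume "v \<in> verts G - {r}" "f e \<le> f (p v)" "- f e \<le> - f (p' v)"
    then show False using F'[of v] by simp
  qed (use F'' in \<open>auto dest: less_imp_le\<close>)
  have 2: "edge_independent r (?T a) (?T a')"
  proof (rule edge_independent_parent_maps[OF pm(3,4), where \<kappa> = g and \<kappa>' = "\<lambda>e. - g e"])
    fix v e assume "v \<in> verts G - {r}" "g e \<le> g (a v)" "- g e \<le> - g (a' v)"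
    then show False using B'[of v] by simp
  qed (use B'' in \<open>auto dest: less_imp_le\<close>)
  \<comment> \<open>Forward paths to a vertex \<open>z\<close> use chains of index at most
    \<open>t z\<close>; backward paths use reversed indices at most \<open>s z\<close>, which is
    less than \<open>m - t z\<close>, hence chains of index above \<open>t z\<close>.\<close>
  have mixed: "edge_independent r (?T x) (?T y)"
    if xy: "parent_map G r x u h" "parent_map G r y v k"
      and mono: "\<And>z. z \<in> verts G - {r} \<Longrightarrow> u z \<noteq> r \<Longrightarrow> cix (x (u z)) \<le> cix (x z)"
        "\<And>z. z \<in> verts G - {r} \<Longrightarrow> v z \<noteq> r \<Longrightarrow> m - cix (y (v z)) \<le> m - cix (y z)"
      and bound: "\<And>z. z \<in> verts G - {r} \<Longrightarrow> cix (x z) \<le> t z"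
        "\<And>z. z \<in> verts G - {r} \<Longrightarrow> m - cix (y z) \<le> s z" for x y u v h k
  proof (rule edge_independent_parent_maps[OF xy, where \<kappa> = cix and \<kappa>' = "\<lambda>e. m - cix e"])
    fix z e assume "z \<in> verts G - {r}" "e \<in> edges G" "cix e \<le> cix (x z)"
      "m - cix e \<le> m - cix (y z)"
    then show False using bound[of z] s[of z] cix_le[of e] by linarith
  qed (use mono in auto)
  have 3: "edge_independent r (?T p) (?T a)"
    using mixed[OF pm(1,3), OF up down] F' B' by blast
  have 4: "edge_independent r (?T p) (?T a')"
    using mixed[OF pm(1,4), OF up down'] F' B' by blast
  have 5: "edge_independent r (?T p') (?T a)"
    using mixed[OF pm(2,3), OF up' down] F' B' by blast
  have 6: "edge_independent r (?T p') (?T a')"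
    using mixed[OF pm(2,4), OF up' down'] F' B' by blast
  define T where "T i = [?T p, ?T p', ?T a, ?T a'] ! i" for i
  have T: "T 0 = ?T p" "T 1 = ?T p'" "T 2 = ?T a" "T 3 = ?T a'"
    by (simp_all add: T_def numeral_2_eq_2 numeral_3_eq_3)
  have less_4: "i < 4 \<longleftrightarrow> i = 0 \<or> i = 1 \<or> i = 2 \<or> i = 3" for i :: nat by auto
  have "\<forall>i<4. spanning_tree (T i) G"
    unfolding less_4 using pm[THEN parent_map.spanning_tree_parent_tree] T by auto
  moreover have "\<forall>i<4. \<forall>j<4. i \<noteq> j \<longrightarrow> edge_independent r (T i) (T j)"
    unfolding less_4 using 1 2 3 4 5 6 T edge_independent_sym by auto
  ultimately show ?thesis by blast
qed

end
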